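(* Let $(L_t)_{t\ge 0}$ be the spectrally negative compound Poisson process $L_t = ct-\sum_{i=1}^{N_t}\xi_i$ with drift $c>0$, intensity $\lambda>0$ and jump distribution $\Pi$ (the law of $\xi_1$). Then for every $q\ge 0$ the $q$-scale function $W^{(q)}$ of $(L_t)_{t\ge0}$ is given by $$W^{(q)}(x)=\frac1c\sum_{k=0}^{\infty}\int_{[0,x]} g_k(s,x)\,\Pi^{*k}(\mathrm{d}s),\qquad x\ge 0,$$ where $$g_k(s,x)=\frac{(\lambda/c)^k}{k!}\,e^{-\frac{q+\lambda}{c}(s-x)}(s-x)^k,\qquad s,x\ge 0,\ k\in\mathbb{N}.$$
   Context: Here $\mathbb{N}=\{0,1,2,\dots\}$. $(N_t)_{t\ge0}$ is a Poisson process with intensity $\lambda>0$, and $(\xi_i)_{i\ge1}$ are i.i.d. random variables, independent of $(N_t)$, with law $\Pi$, a probability measure on $(0,\infty)$. The Laplace exponent is $\psi(u)=\log\mathbb{E}[e^{uL_1}]=cu+\lambda\int_{(0,\infty)}(e^{-ux}-1)\,\Pi(\mathrm{d}x)$, $u\ge0$. For $q\ge0$ put $\Phi(q)=\sup\{y\ge 0:\psi(y)=q\}$; the $q$-scale function $W^{(q)}:[0,\infty)\to\mathbb{R}$ is the unique continuous function with $\int_0^\infty e^{-\beta x}W^{(q)}(x)\,\mathrm{d}x=\frac{1}{\psi(\beta)-q}$ for all $\beta>\Phi(q)$. $\Pi^{*k}$ is the $k$-th convolution power of $\Pi$, with $\Pi^{*0}=\delta_0$. Convention: $0^0=1$. 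*)

theory Defs
  imports "HOL-Probability.Probability"
begin

text \<open>
  Path properties are only required almost surely. The law of an increment is stated additively
  and independence is stated for integer differences, so truncated subtraction on naturals
  never occurs.
\<close>

definition poisson_process :: "'a measure \<Rightarrow> real \<Rightarrow> (real \<Rightarrow> 'a \<Rightarrow> nat) \<Rightarrow> bool" where
  "poisson_process M lam N \<longleftrightarrow>
     (\<forall>t\<ge>0. N t \<in> measurable M (count_space UNIV)) \<and>
     (AE \<omega> in M. N 0 \<omega> = 0) \<and>
     (AE \<omega> in M. mono_on {0..} (\<lambda>t. N t \<omega>) \<and>
        (\<forall>t\<ge>0. continuous (at_right t) (\<lambda>s. real (N s \<omega>)))) \<and>
     (\<forall>s t k. 0 \<le> s \<longrightarrow> s < t \<longrightarrow>
        measure M {\<omega> \<in> space M. N t \<omega> = N s \<omega> + k} = pmf (poisson_pmf (lam * (t - s))) k) \<and>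
     (\<forall>n (t :: nat \<Rightarrow> real). 0 \<le> t 0 \<longrightarrow> (\<forall>i<n. t i < t (Suc i)) \<longrightarrow>
        prob_space.indep_vars M (\<lambda>_. count_space UNIV)
          (\<lambda>i \<omega>. int (N (t (Suc i)) \<omega>) - int (N (t i) \<omega>)) {..<n})"

text \<open>
  The sequence of jumps is indexed by the positive integers; its value at index 0 is never used.
\<close>

definition iid_seq :: "'a measure \<Rightarrow> real measure \<Rightarrow> (nat \<Rightarrow> 'a \<Rightarrow> real) \<Rightarrow> bool" where
  "iid_seq M \<nu> \<xi> \<longleftrightarrow>
     prob_space.indep_vars M (\<lambda>_. borel) \<xi> {1..} \<and> (\<forall>i\<ge>1. distr M borel (\<xi> i) = \<nu>)"

text \<open>
  Independence of the two whole families, i.e. of the sigma-algebras they generate on the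
  sample space. (The library's \<open>indep_var\<close> needs both random elements to have the same type.)
\<close>

definition indep_of_process :: "'a measure \<Rightarrow> (real \<Rightarrow> 'a \<Rightarrow> nat) \<Rightarrow> (nat \<Rightarrow> 'a \<Rightarrow> real) \<Rightarrow> bool" where
  "indep_of_process M N \<xi> \<longleftrightarrow>
     prob_space.indep_set M
       (sets (vimage_algebra (space M) (\<lambda>\<omega>. \<lambda>t\<in>{0..}. N t \<omega>) (\<Pi>\<^sub>M t\<in>{0..}. count_space UNIV)))
       (sets (vimage_algebra (space M) (\<lambda>\<omega>. \<lambda>i\<in>{1..}. \<xi> i \<omega>) (\<Pi>\<^sub>M i\<in>{1..}. borel)))"

definition compound_poisson ::
    "real \<Rightarrow> (real \<Rightarrow> 'a \<Rightarrow> nat) \<Rightarrow> (nat \<Rightarrow> 'a \<Rightarrow> real) \<Rightarrow> real \<Rightarrow> 'a \<Rightarrow> real" where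
  "compound_poisson c N \<xi> t \<omega> = c * t - (\<Sum>i=1..N t \<omega>. \<xi> i \<omega>)"

definition laplace_exponent :: "'a measure \<Rightarrow> (real \<Rightarrow> 'a \<Rightarrow> real) \<Rightarrow> real \<Rightarrow> real" where
  "laplace_exponent M L u = ln (\<integral>\<omega>. exp (u * L 1 \<omega>) \<partial>M)"

definition right_inverse :: "(real \<Rightarrow> real) \<Rightarrow> real \<Rightarrow> real" where
  "right_inverse \<psi> q = Sup {y. 0 \<le> y \<and> \<psi> y = q}"

text \<open>
  A function on the closed half-line is encoded as a function on the reals that vanishes on the
  negative half-line, so that uniqueness on the half-line is uniqueness of the encoding.
\<close>

definition is_scale_function :: "(real \<Rightarrow> real) \<Rightarrow> real \<Rightarrow> (real \<Rightarrow> real) \<Rightarrow> bool" where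
  "is_scale_function \<psi> q W \<longleftrightarrow>
     continuous_on {0..} W \<and> (\<forall>x<0. W x = 0) \<and>
     (\<forall>\<beta>>right_inverse \<psi> q.
        set_integrable lborel {0..} (\<lambda>x. exp (- \<beta> * x) * W x) \<and>
        (LINT x:{0..}|lborel. exp (- \<beta> * x) * W x) = 1 / (\<psi> \<beta> - q))"

definition scale_function :: "(real \<Rightarrow> real) \<Rightarrow> real \<Rightarrow> real \<Rightarrow> real" where
  "scale_function \<psi> q = (THE W. is_scale_function \<psi> q W)"

primrec convolution_power :: "real measure \<Rightarrow> nat \<Rightarrow> real measure" where
  "convolution_power \<nu> 0 = return borel 0"
| "convolution_power \<nu> (Suc k) = convolution \<nu> (convolution_power \<nu> k)"

definition scale_kernel :: "real \<Rightarrow> real \<Rightarrow> real \<Rightarrow> nat \<Rightarrow> real \<Rightarrow> real \<Rightarrow> real" where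
  "scale_kernel c lam q k s x =
     (lam / c) ^ k / fact k * exp (- ((q + lam) / c) * (s - x)) * (s - x) ^ k"

end

theory Submission
  imports Defs
begin

text \<open>
  Put \<open>a = (q + \<lambda>) / c\<close> and \<open>b = \<lambda> / c\<close>, and let \<open>V\<close> be the series of the theorem without the
  prefactor. Its terms are \<open>w\<^sub>k * \<Pi>\<^sup>*\<^sup>k\<close>, where \<open>w\<^sub>k\<close> vanishes on the negative half-line and satisfies
  \<open>w\<^sub>k' = a w\<^sub>k - b w\<^sub>k\<^sub>-\<^sub>1\<close>. Integrating and summing over \<open>k\<close> gives the renewal equation
  \<open>V = 1 + V * K\<close> on the half-line, where \<open>K(x) = a - b \<Pi>((0,x])\<close>.
  Integrating the alternating series term by term would give its Laplace transform only for large
  \<open>\<beta>\<close>. The kernel \<open>K\<close>, however, is nonnegative, so \<open>V\<close> is nonnegative, and the Laplace transform of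
  the renewal equation can be solved for \<open>V\<close> whenever the transform of \<open>K\<close> is below 1, that is,
  whenever \<open>\<psi>(\<beta>) > q\<close>, and thus for every \<open>\<beta> > \<Phi>(q)\<close>.
  A continuous function with vanishing Laplace transform is zero by Weierstrass approximation in
  the variable \<open>exp (-x)\<close>, so \<open>V / c\<close> is the scale function.
\<close>

section \<open>Convolution of causal functions\<close>

text \<open>The bound holds on all of \<open>y \<le> X\<close>, so it covers every shifted argument
  \<open>x - s\<close> with \<open>s \<ge> 0\<close> and keeps the convolution integrands
  bounded.\<close>

definition causal :: "(real \<Rightarrow> real) \<Rightarrow> bool" where
  "causal f \<longleftrightarrow> f \<in> borel_measurable borel \<and> (\<forall>x<0. f x = 0) \<and> (\<forall>X. \<exists>B. \<forall>x\<le>X. \<bar>f x\<bar> \<le> B)"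

definition positive_law :: "real measure \<Rightarrow> bool" where
  "positive_law P \<longleftrightarrow> prob_space P \<and> sets P = sets borel \<and> (AE s in P. 0 \<le> s)"

text \<open>The integral runs over the whole line; for causal factors the integrand vanishes outside
  \<open>{0..x}\<close>.\<close>

definition conv :: "(real \<Rightarrow> real) \<Rightarrow> (real \<Rightarrow> real) \<Rightarrow> real \<Rightarrow> real" where
  "conv f g x = (LINT z|lborel. f (x - z) * g z)"

definition mconv :: "(real \<Rightarrow> real) \<Rightarrow> real measure \<Rightarrow> real \<Rightarrow> real" where
  "mconv f P x = (LINT s|P. f (x - s))"

text \<open>Convolution with this function is integration from 0, so that differential equations
  become convolution identities.\<close>

definition heaviside :: "real \<Rightarrow> real" where
  "heaviside = indicator {0..}"

lemma causalI:
  assumes "f \<in> borel_measurable borel" "\<And>x. x < 0 \<Longrightarrow> f x = 0"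
    and "\<And>X. 0 \<le> X \<Longrightarrow> \<exists>B. \<forall>x\<in>{0..X}. \<bar>f x\<bar> \<le> B"
  shows "causal f"
  unfolding causal_def
proof (intro conjI allI)
  fix X
  obtain B where B: "\<And>x. x \<in> {0..max 0 X} \<Longrightarrow> \<bar>f x\<bar> \<le> B"
    using assms(3)[of "max 0 X"] by fastforce
  have "0 \<le> B" using B[of 0] by auto
  then have "\<bar>f x\<bar> \<le> B" if "x \<le> X" for x
    using B[of x] assms(2)[of x] that by (cases "x < 0") auto
  then show "\<exists>B. \<forall>x\<le>X. \<bar>f x\<bar> \<le> B" by auto
qed (use assms in auto)

lemma causal_measurable [measurable_dest]: "causal f \<Longrightarrow> f \<in> borel_measurable borel"
  and causal_neg: "causal f \<Longrightarrow> x < 0 \<Longrightarrow> f x = 0"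
  by (auto simp: causal_def)

lemma causal_bound:
  assumes "causal f" obtains B where "0 \<le> B" "\<forall>x\<le>X. \<bar>f x\<bar> \<le> B"
proof -
  obtain B where B: "\<forall>x\<le>X. \<bar>f x\<bar> \<le> B" using assms unfolding causal_def by blast
  then have "\<bar>f X\<bar> \<le> B" by auto
  then show ?thesis using B that[of B] by auto
qed

lemma causal_heaviside: "causal heaviside"
  by (rule causalI) (auto simp: heaviside_def indicator_def)

lemma causal_add: "causal f \<Longrightarrow> causal g \<Longrightarrow> causal (\<lambda>x. f x + g x)"
  and causal_cmult: "causal f \<Longrightarrow> causal (\<lambda>x. d * f x)"
proof -
  show "causal (\<lambda>x. f x + g x)" if fg: "causal f" "causal g"
  proof (rule causalI)
    fix X :: real
    obtain B where "0 \<le> B" "\<forall>x\<le>X. \<bar>f x\<bar> \<le> B" by (rule causal_bound[OF fg(1), where X=X])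
    moreover obtain C where "0 \<le> C" "\<forall>x\<le>X. \<bar>g x\<bar> \<le> C" by (rule causal_bound[OF fg(2), where X=X])
    ultimately have "\<forall>x\<in>{0..X}. \<bar>f x + g x\<bar> \<le> B + C"
      by (smt (verit) atLeastAtMost_iff)
    then show "\<exists>B. \<forall>x\<in>{0..X}. \<bar>f x + g x\<bar> \<le> B" by blast
  qed (use fg in \<open>auto simp: causal_neg[OF fg(1)] causal_neg[OF fg(2)]\<close>)
  show "causal (\<lambda>x. d * f x)" if f: "causal f"
  proof (rule causalI)
    fix X :: real
    obtain B where "0 \<le> B" "\<forall>x\<le>X. \<bar>f x\<bar> \<le> B" by (rule causal_bound[OF f, where X=X])
    then have "\<forall>x\<in>{0..X}. \<bar>d * f x\<bar> \<le> \<bar>d\<bar> * B" by (auto simp: abs_mult intro!: mult_left_mono)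
    then show "\<exists>B. \<forall>x\<in>{0..X}. \<bar>d * f x\<bar> \<le> B" by blast
  qed (use f in \<open>auto simp: causal_neg[OF f]\<close>)
qed

section \<open>Laws on the closed half-line and their action on causal functions\<close>

lemma positive_law_convolution:
  assumes P: "positive_law P" and Q: "positive_law Q"
  shows "positive_law (convolution Q P)"
proof -
  interpret P: prob_space P using P by (simp add: positive_law_def)
  interpret Q: prob_space Q using Q by (simp add: positive_law_def)
  interpret PQ: pair_prob_space Q P ..
  have [measurable_cong]: "sets P = sets borel" "sets Q = sets borel"
    using P Q by (auto simp: positive_law_def)
  have "AE x in Q \<Otimes>\<^sub>M P. 0 \<le> fst x + snd x"
  proof (rule PQ.AE_pair_measure)
    show "AE x in Q. AE y in P. 0 \<le> fst (x, y) + snd (x, y)"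
      using P Q by (auto simp: positive_law_def)
  qed measurable
  then show ?thesis
    unfolding positive_law_def convolution_def
    by (auto simp: AE_distr_iff split_beta intro!: PQ.prob_space_distr)
qed

lemma positive_law_convolution_power:
  assumes "positive_law P" shows "positive_law (convolution_power P k)"
proof (induction k)
  case 0
  then show ?case
    by (auto simp: positive_law_def AE_return intro!: prob_space_return)
qed (simp add: assms positive_law_convolution)

lemma integrable_shift:
  assumes f: "causal f" and P: "positive_law P"
  shows "integrable P (\<lambda>s. f (x - s))"
proof -
  interpret P: prob_space P using P by (simp add: positive_law_def)
  have [measurable_cong]: "sets P = sets borel" using P by (auto simp: positive_law_def)
  note [measurable] = causal_measurable[OF f]
  obtain B where "0 \<le> B" and B[rule_format]: "\<forall>y\<le>x. \<bar>f y\<bar> \<le> B" by (rule causal_bound[OF f, where X=x])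
  have "AE s in P. 0 \<le> s" using P by (simp add: positive_law_def)
  then have "AE s in P. norm (f (x - s)) \<le> B" by eventually_elim (auto intro!: B)
  then show ?thesis by (intro P.integrable_const_bound) auto
qed

text \<open>Almost every \<open>s\<close> keeps \<open>x - s\<close> below \<open>x\<close>, and the
  total mass is 1. A bound for a kernel thus passes unchanged to its convolution with any power of
  the jump law.\<close>

lemma mconv_bound:
  assumes P: "positive_law P" and [measurable]: "f \<in> borel_measurable borel"
    and B: "\<And>y. y \<le> x \<Longrightarrow> \<bar>f y\<bar> \<le> B"
  shows "\<bar>mconv f P x\<bar> \<le> B"
proof -
  interpret P: prob_space P using P by (simp add: positive_law_def)
  have [measurable_cong]: "sets P = sets borel" using P by (auto simp: positive_law_def)
  have ae: "AE s in P. 0 \<le> s" using P by (simp add: positive_law_def)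
  have bd: "AE s in P. norm (f (x - s)) \<le> B" using ae by eventually_elim (auto intro!: B)
  have int: "integrable P (\<lambda>s. f (x - s))"
    using bd by (intro P.integrable_const_bound) auto
  have "\<bar>mconv f P x\<bar> \<le> (LINT s|P. \<bar>f (x - s)\<bar>)"
    unfolding mconv_def by (rule integral_abs_bound)
  also have "\<dots> \<le> B"
    using integral_mono_AE[of P "\<lambda>s. \<bar>f (x - s)\<bar>" "\<lambda>s. B"] int bd
    by (simp add: P.prob_space)
  finally show ?thesis .
qed

lemma causal_mconv:
  assumes f: "causal f" and P: "positive_law P"
  shows "causal (mconv f P)"
proof -
  interpret P: prob_space P using P by (simp add: positive_law_def)
  have [measurable_cong]: "sets P = sets borel" using P by (auto simp: positive_law_def)
  note [measurable] = causal_measurable[OF f]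
  have ae: "AE s in P. 0 \<le> s" using P by (simp add: positive_law_def)
  have "mconv f P \<in> borel_measurable borel" unfolding mconv_def by measurable
  moreover have "mconv f P x = 0" if "x < 0" for x
  proof -
    have "AE s in P. f (x - s) = 0" using ae by eventually_elim (use that in \<open>auto simp: causal_neg[OF f]\<close>)
    then show ?thesis unfolding mconv_def by (rule integral_eq_zero_AE)
  qed
  moreover have "\<exists>B. \<forall>x\<in>{0..X}. \<bar>mconv f P x\<bar> \<le> B" for X
  proof -
    obtain B where "0 \<le> B" and B: "\<forall>x\<le>X. \<bar>f x\<bar> \<le> B" by (rule causal_bound[OF f, where X=X])
    then have "\<bar>mconv f P x\<bar> \<le> B" if "x \<le> X" for x using that by (intro mconv_bound[OF P] causal_measurable[OF f]) auto
    then show ?thesis by (metis atLeastAtMost_iff)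
  qed
  ultimately show ?thesis by (intro causalI) auto
qed

section \<open>Convolution of two causal functions\<close>

text \<open>For \<open>z\<close> outside \<open>{0..X}\<close> one of the two factors has a negative
  argument. The majorant is the same for all \<open>y \<le> X\<close>, so it survives a further
  shift of \<open>y\<close> to the left.\<close>

lemma conv_integrand_bound:
  assumes f: "causal f" and g: "causal g"
  obtains B where "0 \<le> B" "\<forall>y\<le>X. \<forall>z. \<bar>f (y - z) * g z\<bar> \<le> B * indicator {0..X} z"
proof -
  obtain B where B[rule_format]: "0 \<le> B" "\<forall>x\<le>X. \<bar>f x\<bar> \<le> B" by (rule causal_bound[OF f, where X=X])
  obtain C where C[rule_format]: "0 \<le> C" "\<forall>x\<le>X. \<bar>g x\<bar> \<le> C" by (rule causal_bound[OF g, where X=X])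
  have "\<bar>f (y - z) * g z\<bar> \<le> B * C * indicator {0..X} z" if "y \<le> X" for y z
  proof (cases "z \<in> {0..X}")
    case True
    then show ?thesis using B C that by (auto simp: abs_mult intro!: mult_mono)
  next
    case False
    then have "f (y - z) * g z = 0" using that causal_neg[OF f, of "y - z"] causal_neg[OF g, of z] by auto
    then show ?thesis using B C by auto
  qed
  then show ?thesis using that[of "B * C"] B C by auto
qed

lemma integrable_cmult_indicator_Icc: "integrable lborel (\<lambda>z. B * indicator {a..b::real} z :: real)"
  by (intro integrable_mult_right integrable_real_indicator) (auto simp: emeasure_lborel_Icc_eq)

lemma integrable_conv:
  assumes f: "causal f" and g: "causal g"
  shows "integrable lborel (\<lambda>z. f (x - z) * g z)"
proof -
  note [measurable] = causal_measurable[OF f] causal_measurable[OF g]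
  obtain B where "0 \<le> B" and B[rule_format]: "\<forall>y\<le>x. \<forall>z. \<bar>f (y - z) * g z\<bar> \<le> B * indicator {0..x} z"
    by (rule conv_integrand_bound[OF f g, where X=x])
  show ?thesis
  proof (rule Bochner_Integration.integrable_bound)
    show "integrable lborel (\<lambda>z. B * indicator {0..x} z)" by (rule integrable_cmult_indicator_Icc)
    show "AE z in lborel. norm (f (x - z) * g z) \<le> norm (B * indicator {0..x} z)"
    proof (rule AE_I2)
      fix z
      have "\<bar>f (x - z) * g z\<bar> \<le> B * indicator {0..x} z" by (rule B) simp
      also have "\<dots> \<le> norm (B * indicator {0..x} z)" by simp
      finally show "norm (f (x - z) * g z) \<le> norm (B * indicator {0..x} z)" by simp
    qed
  qed measurable
qed

lemma causal_conv:
  assumes f: "causal f" and g: "causal g"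
  shows "causal (conv f g)"
proof -
  note [measurable] = causal_measurable[OF f] causal_measurable[OF g]
  have "conv f g \<in> borel_measurable borel" unfolding conv_def by measurable
  moreover have "conv f g x = 0" if "x < 0" for x
  proof -
    have "f (x - z) * g z = 0" for z
      using that causal_neg[OF f, of "x - z"] causal_neg[OF g, of z] by (cases "z < 0") auto
    then show ?thesis unfolding conv_def by (simp only: integral_zero)
  qed
  moreover have "\<exists>B. \<forall>x\<in>{0..X}. \<bar>conv f g x\<bar> \<le> B" if "0 \<le> X" for X
  proof -
    obtain B where B[rule_format]: "0 \<le> B" "\<forall>y\<le>X. \<forall>z. \<bar>f (y - z) * g z\<bar> \<le> B * indicator {0..X} z"
      by (rule conv_integrand_bound[OF f g, where X=X])
    have "\<bar>conv f g x\<bar> \<le> B * X" if "x \<le> X" for x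
    proof -
      have "\<bar>conv f g x\<bar> \<le> (LINT z|lborel. \<bar>f (x - z) * g z\<bar>)"
        unfolding conv_def by (rule integral_abs_bound)
      also have "\<dots> \<le> (LINT z|lborel. B * indicator {0..X} z)"
        using B(2)[OF that] integrable_conv[OF f g]
        by (intro integral_mono integrable_abs integrable_cmult_indicator_Icc) auto
      also have "\<dots> = B * X" using \<open>0 \<le> X\<close> by simp
      finally show ?thesis .
    qed
    then show ?thesis by (metis atLeastAtMost_iff)
  qed
  ultimately show ?thesis by (intro causalI) auto
qed

lemma conv_commute: "conv f g = conv g f"
proof
  fix x
  have "conv f g x = (LINT z|lborel. f (x - (x + (- 1) * z)) * g (x + (- 1) * z))"
    unfolding conv_def by (subst lborel_integral_real_affine[of "-1" _ x]) auto
  also have "\<dots> = conv g f x" unfolding conv_def by (simp add: mult.commute)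
  finally show "conv f g x = conv g f x" .
qed

text \<open>Fubini for \<open>P\<close> and Lebesgue measure: the law may be absorbed into the first
  factor.\<close>

lemma mconv_conv:
  assumes f: "causal f" and g: "causal g" and P: "positive_law P"
  shows "mconv (conv f g) P = conv (mconv f P) g"
proof
  fix x
  interpret P: prob_space P using P by (simp add: positive_law_def)
  interpret PL: pair_sigma_finite P lborel ..
  have [measurable_cong]: "sets P = sets borel" using P by (auto simp: positive_law_def)
  note [measurable] = causal_measurable[OF f] causal_measurable[OF g]
  have ae: "AE s in P. 0 \<le> s" using P by (simp add: positive_law_def)
  obtain B where B[rule_format]: "0 \<le> B" "\<forall>y\<le>x. \<forall>z. \<bar>f (y - z) * g z\<bar> \<le> B * indicator {0..x} z"
    by (rule conv_integrand_bound[OF f g, where X=x])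
  \<comment> \<open>Almost every \<open>s\<close> is nonnegative, so one majorant on
    \<open>{0..x}\<close> serves for all shifts; it is integrable on the product because
    \<open>P\<close> has mass 1.\<close>
  have "integrable (P \<Otimes>\<^sub>M lborel) (\<lambda>(s, z). f (x - s - z) * g z)"
  proof (rule Bochner_Integration.integrable_bound)
    show "integrable (P \<Otimes>\<^sub>M lborel) (\<lambda>p. B * indicator (UNIV \<times> {0..x}) p)"
    proof -
      have "emeasure (P \<Otimes>\<^sub>M lborel) (space P \<times> {0..x}) < \<infinity>"
        by (subst lborel.emeasure_pair_measure_Times) (auto simp: P.emeasure_space_1 emeasure_lborel_Icc_eq)
      moreover have "space P = UNIV" using sets_eq_imp_space_eq[of P borel] by (simp add: \<open>sets P = sets borel\<close>)
      moreover have "UNIV \<times> {0..x} \<in> sets (P \<Otimes>\<^sub>M lborel)" by measurable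
      ultimately show ?thesis by (intro integrable_mult_right integrable_real_indicator) auto
    qed
    show "AE p in P \<Otimes>\<^sub>M lborel. norm (case p of (s, z) \<Rightarrow> f (x - s - z) * g z)
        \<le> norm (B * indicator (UNIV \<times> {0..x}) p)"
    proof (rule PL.AE_pair_measure)
      show "AE s in P. AE z in lborel. norm (case (s, z) of (s, z) \<Rightarrow> f (x - s - z) * g z)
          \<le> norm (B * indicator (UNIV \<times> {0..x}) (s, z))"
        using ae
      proof eventually_elim
        case (elim s)
        then have "\<bar>f (x - s - z) * g z\<bar> \<le> B * indicator {0..x} z" for z
          by (intro B(2)) simp
        then show ?case using B(1) by (intro AE_I2) (simp add: indicator_times)
      qed
    qed measurable
  qed measurable
  then have "(LINT z|lborel. LINT s|P. f (x - s - z) * g z) = (LINT s|P. LINT z|lborel. f (x - s - z) * g z)"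
    by (rule PL.Fubini_integral)
  moreover have "(LINT s|P. f (x - s - z) * g z) = mconv f P (x - z) * g z" for z
  proof -
    have "(LINT s|P. f (x - s - z) * g z) = (LINT s|P. f (x - s - z)) * g z" by simp
    also have "(LINT s|P. f (x - s - z)) = mconv f P (x - z)"
      unfolding mconv_def by (intro Bochner_Integration.integral_cong arg_cong[of _ _ f]) auto
    finally show ?thesis .
  qed
  ultimately show "mconv (conv f g) P x = conv (mconv f P) g x"
    unfolding mconv_def[of "conv f g"] conv_def by (simp only:)
qed

text \<open>\<open>convolution Q P\<close> is the law of a sum of independent variables, so Fubini
  splits its integral. The order of the factors matches the recursion of
  \<open>convolution_power\<close>.\<close>

lemma mconv_mconv:
  assumes f: "causal f" and P: "positive_law P" and Q: "positive_law Q"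
  shows "mconv (mconv f P) Q = mconv f (convolution Q P)"
proof
  fix x
  interpret P: prob_space P using P by (simp add: positive_law_def)
  interpret Q: prob_space Q using Q by (simp add: positive_law_def)
  interpret PQ: pair_prob_space Q P ..
  have [measurable_cong]: "sets P = sets borel" "sets Q = sets borel"
    using P Q by (auto simp: positive_law_def)
  note [measurable] = causal_measurable[OF f]
  have "integrable (convolution Q P) (\<lambda>u. f (x - u))"
    by (rule integrable_shift[OF f positive_law_convolution[OF P Q]])
  then have int: "integrable (Q \<Otimes>\<^sub>M P) (\<lambda>p. f (x - (fst p + snd p)))"
    unfolding convolution_def by (subst (asm) integrable_distr_eq) (auto simp: split_beta)
  have "mconv f (convolution Q P) x = (LINT p|(Q \<Otimes>\<^sub>M P). f (x - (fst p + snd p)))"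
    unfolding convolution_def mconv_def by (subst integral_distr) (auto simp: split_beta)
  also have "\<dots> = (LINT t|Q. LINT s|P. f (x - (t + s)))"
    using PQ.integral_fst'[OF int] by simp
  also have "\<dots> = mconv (mconv f P) Q x" by (simp add: mconv_def algebra_simps)
  finally show "mconv (mconv f P) Q x = mconv f (convolution Q P) x" ..
qed

section \<open>The renewal equation\<close>

lemma conv_heaviside:
  assumes "causal f" shows "conv f heaviside x = (LINT z|lborel. f z * indicator {0..x} z)"
proof -
  have "heaviside (x - z) * f z = f z * indicator {0..x} z" for z
    using causal_neg[OF assms, of z] by (auto simp: heaviside_def indicator_def)
  then show ?thesis by (subst conv_commute) (simp only: conv_def)
qed

lemma conv_add_left:
  assumes "causal f" "causal g" "causal h"
  shows "conv (\<lambda>x. f x + g x) h x = conv f h x + conv g h x"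
  unfolding conv_def distrib_right
  by (rule Bochner_Integration.integral_add) (use assms in \<open>auto intro: integrable_conv\<close>)

lemma conv_cmult_left: "conv (\<lambda>x. d * f x) h x = d * conv f h x"
  unfolding conv_def by (simp add: mult.assoc)

lemma mconv_add:
  assumes "causal f" "causal g" "positive_law P"
  shows "mconv (\<lambda>x. f x + g x) P x = mconv f P x + mconv g P x"
  unfolding mconv_def
  by (rule Bochner_Integration.integral_add) (use assms in \<open>auto intro: integrable_shift\<close>)

lemma mconv_cmult: "mconv (\<lambda>x. d * f x) P x = d * mconv f P x"
  unfolding mconv_def by simp

text \<open>The sign of \<open>(s - x) ^ k\<close> in the scale kernel is kept, with \<open>y = x - s\<close>; note \<open>0 ^ 0 = 1\<close> at \<open>y = 0\<close>.\<close>

definition resolvent_kernel :: "real \<Rightarrow> real \<Rightarrow> nat \<Rightarrow> real \<Rightarrow> real" where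
  "resolvent_kernel a b k y = (if y < 0 then 0 else b ^ k / fact k * exp (a * y) * (- y) ^ k)"

text \<open>In absolute value the alternating sign disappears and the kernel increases in
  \<open>y\<close> on the half-line. What remains is a term of the exponential series at
  \<open>b * X\<close>.\<close>

lemma resolvent_kernel_bound:
  assumes "0 \<le> a" "0 \<le> b" "0 \<le> X" "y \<le> X"
  shows "\<bar>resolvent_kernel a b k y\<bar> \<le> exp (a * X) * ((b * X) ^ k / fact k)"
proof (cases "y < 0")
  case False
  have "\<bar>resolvent_kernel a b k y\<bar> = exp (a * y) * (b ^ k * y ^ k / fact k)"
    using False assms by (simp add: resolvent_kernel_def abs_mult power_abs)
  also have "\<dots> \<le> exp (a * X) * (b ^ k * X ^ k / fact k)"
    using False assms
    by (intro mult_mono divide_right_mono mult_left_mono power_mono) (auto intro: mult_left_mono)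
  finally show ?thesis by (simp add: power_mult_distrib)
qed (use assms in \<open>auto simp: resolvent_kernel_def\<close>)

lemma causal_resolvent_kernel:
  assumes "0 \<le> a" "0 \<le> b" shows "causal (resolvent_kernel a b k)"
proof (rule causalI)
  show "resolvent_kernel a b k \<in> borel_measurable borel" unfolding resolvent_kernel_def[abs_def] by measurable
  show "\<exists>B. \<forall>y\<in>{0..X}. \<bar>resolvent_kernel a b k y\<bar> \<le> B" if "0 \<le> X" for X
    using resolvent_kernel_bound[OF assms that] by (meson atLeastAtMost_iff)
qed (simp add: resolvent_kernel_def)

text \<open>This is the integrated form of \<open>w' = a w\<close> with \<open>w 0 = 1\<close>; the
  Heaviside function is the constant of integration.\<close>

lemma resolvent_kernel_0:
  assumes a: "0 \<le> a" and b: "0 \<le> b"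
  shows "resolvent_kernel a b 0 x = heaviside x + a * conv (resolvent_kernel a b 0) heaviside x"
proof (cases "x < 0")
  case True
  then show ?thesis
    using causal_neg[OF causal_conv[OF causal_resolvent_kernel[OF assms] causal_heaviside]]
    by (simp add: resolvent_kernel_def heaviside_def)
next
  case False
  have "a * conv (resolvent_kernel a b 0) heaviside x = (LINT z|lborel. (a * exp (a * z)) * indicator {0..x} z)"
    unfolding conv_heaviside[OF causal_resolvent_kernel[OF assms]]
    by (subst integral_mult_right_zero[symmetric], intro Bochner_Integration.integral_cong)
      (auto simp: resolvent_kernel_def indicator_def)
  also have "\<dots> = exp (a * x) - exp (a * 0)"
    by (rule integral_FTC_Icc_real) (use False in \<open>auto intro!: derivative_eq_intros continuous_intros\<close>)
  finally show ?thesis using False by (simp add: resolvent_kernel_def heaviside_def)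
qed

text \<open>The differential equation between consecutive kernels, integrated from 0. The initial
  value is 0, hence no Heaviside term; the sign of \<open>b\<close> comes from differentiating
  \<open>(- y) ^ Suc k\<close>.\<close>

lemma resolvent_kernel_Suc:
  assumes a: "0 \<le> a" and b: "0 \<le> b"
  shows "resolvent_kernel a b (Suc k) = conv (\<lambda>y. a * resolvent_kernel a b (Suc k) y + (- b) * resolvent_kernel a b k y) heaviside"
    (is "_ = conv ?g _")
proof
  fix x
  have g: "causal ?g" by (intro causal_add causal_cmult causal_resolvent_kernel assms)
  show "resolvent_kernel a b (Suc k) x = conv ?g heaviside x"
  proof (cases "x < 0")
    case True
    then show ?thesis
      using causal_neg[OF causal_conv[OF g causal_heaviside]] by (simp add: resolvent_kernel_def)
  next
    case False
    \<comment> \<open>Without the cut at 0 the kernel is smooth on the whole line, so the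
      fundamental theorem of calculus applies up to the end point 0.\<close>
    define p where "p j y = b ^ j / fact j * exp (a * y) * (- y) ^ j" for j and y :: real
    have "conv ?g heaviside x = (LINT z|lborel. (a * p (Suc k) z + (- b) * p k z) * indicator {0..x} z)"
      unfolding conv_heaviside[OF g]
      by (intro Bochner_Integration.integral_cong) (auto simp: resolvent_kernel_def p_def indicator_def)
    also have "\<dots> = p (Suc k) x - p (Suc k) 0"
    proof (rule integral_FTC_Icc_real)
      fix y
      \<comment> \<open>The factor \<open>Suc k\<close> from the power rule lowers the factorial and
        leaves a single \<open>b\<close>.\<close>
      have fct: "b ^ Suc k / fact (Suc k) * real (Suc k) = b * (b ^ k / fact k)"
        by (simp add: fact_Suc del: of_nat_Suc)
      have "((\<lambda>y. b ^ Suc k / fact (Suc k) * exp (a * y) * (- y) ^ Suc k) has_real_derivative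
        a * p (Suc k) y - (b ^ Suc k / fact (Suc k) * real (Suc k)) * exp (a * y) * (- y) ^ k) (at y)"
        unfolding p_def
        by (rule derivative_eq_intros refl | simp add: algebra_simps del: of_nat_Suc fact_Suc power_Suc)+
      then show "(p (Suc k) has_real_derivative a * p (Suc k) y + - b * p k y) (at y)"
        unfolding fct p_def[abs_def] by (simp only: mult.assoc mult_minus_left diff_conv_add_uminus)
      show "isCont (\<lambda>y. a * p (Suc k) y + - b * p k y) y"
        unfolding p_def by (intro continuous_intros) auto
    qed (use False in auto)
    finally show ?thesis using False by (simp add: resolvent_kernel_def p_def)
  qed
qed

section \<open>Series of causal functions with summable majorants\<close>

lemma summable_exp_series: "summable (\<lambda>k. C * ((y::real) ^ k / fact k))"
  using summable_mult[OF summable_exp[of y], of C] by (simp add: field_simps)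

text \<open>The Weierstrass majorant test on each half-line \<open>x \<le> X\<close>, with a
  majorant that may depend on \<open>X\<close>.\<close>

lemma causal_suminf:
  assumes f: "\<And>k. causal (f k)"
    and B: "\<And>X. 0 \<le> X \<Longrightarrow> summable (B X)" "\<And>X k x. 0 \<le> X \<Longrightarrow> x \<le> X \<Longrightarrow> \<bar>f k x\<bar> \<le> B X k"
  shows "summable (\<lambda>k. \<bar>f k x\<bar>)" and "causal (\<lambda>x. \<Sum>k. f k x)"
proof -
  have B': "summable (\<lambda>k. \<bar>f k x\<bar>)" if "0 \<le> X" "x \<le> X" for x X
    by (rule summable_comparison_test'[OF B(1)[OF that(1)]]) (use B(2)[OF that] in auto)
  then show "summable (\<lambda>k. \<bar>f k x\<bar>)" using B'[of "max 0 x"] by simp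
  note [measurable] = causal_measurable[OF f]
  show "causal (\<lambda>x. \<Sum>k. f k x)"
  proof (rule causalI)
    show "(\<lambda>x. \<Sum>k. f k x) \<in> borel_measurable borel" by measurable
    show "(\<Sum>k. f k x) = 0" if "x < 0" for x using causal_neg[OF f that] by simp
    fix X :: real assume X: "0 \<le> X"
    have "\<bar>\<Sum>k. f k x\<bar> \<le> (\<Sum>k. B X k)" if "x \<le> X" for x
    proof -
      have "\<bar>\<Sum>k. f k x\<bar> \<le> (\<Sum>k. \<bar>f k x\<bar>)" by (rule summable_rabs[OF B'[OF X that]])
      also have "\<dots> \<le> (\<Sum>k. B X k)" by (intro suminf_le B'[OF X that] B(1)[OF X] B(2)[OF X that])
      finally show ?thesis .
    qed
    then show "\<exists>C. \<forall>x\<in>{0..X}. \<bar>\<Sum>k. f k x\<bar> \<le> C" by (metis atLeastAtMost_iff)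
  qed
qed

text \<open>The integrands live on \<open>{0..X}\<close> and are dominated there by
  \<open>B X k * C\<close>. Their integrals in absolute value are therefore summable, and sum and
  integral may be exchanged.\<close>

lemma conv_suminf:
  assumes f: "\<And>k. causal (f k)" and g: "causal g"
    and B: "\<And>X. 0 \<le> X \<Longrightarrow> summable (B X)" "\<And>X k x. 0 \<le> X \<Longrightarrow> x \<le> X \<Longrightarrow> \<bar>f k x\<bar> \<le> B X k"
  shows "(\<lambda>k. conv (f k) g x) sums conv (\<lambda>x. \<Sum>k. f k x) g x"
proof -
  note s = causal_suminf(1)[OF f B]
  \<comment> \<open>The majorants are given for nonnegative \<open>X\<close> only, while
    \<open>x\<close> may be negative.\<close>
  define X where "X = max 0 x"
  have X: "0 \<le> X" "x \<le> X" by (auto simp: X_def)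
  obtain C where "0 \<le> C" and C[rule_format]: "\<forall>z\<le>X. \<bar>g z\<bar> \<le> C"
    by (rule causal_bound[OF g, where X=X])
  have B0: "0 \<le> B X k" for k using B(2)[OF X, of k] by linarith
  have bd: "\<bar>f k (x - z) * g z\<bar> \<le> B X k * C * indicator {0..X} z" for k z
  proof (cases "z \<in> {0..X}")
    case True
    then have "\<bar>f k (x - z)\<bar> \<le> B X k" using X by (intro B(2)) auto
    moreover have "\<bar>g z\<bar> \<le> C" using True by (intro C) auto
    ultimately show ?thesis using True B0 by (auto simp: abs_mult intro!: mult_mono)
  next
    case False
    then have "f k (x - z) * g z = 0"
      using X causal_neg[OF f, of "x - z"] causal_neg[OF g, of z] by auto
    then show ?thesis using False by simp
  qed
  have "(\<lambda>k. LINT z|lborel. f k (x - z) * g z) sums (LINT z|lborel. (\<Sum>k. f k (x - z) * g z))"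
  proof (rule sums_integral)
    show "integrable lborel (\<lambda>z. f k (x - z) * g z)" for k by (rule integrable_conv[OF f g])
    show "AE z in lborel. summable (\<lambda>k. norm (f k (x - z) * g z))"
      using summable_mult2[OF s] by (simp add: abs_mult)
    show "summable (\<lambda>k. LINT z|lborel. norm (f k (x - z) * g z))"
    proof (rule summable_comparison_test'[of "\<lambda>k. B X k * (C * X)"])
      show "summable (\<lambda>k. B X k * (C * X))" by (intro summable_mult2 B(1) X)
      fix k
      have "(LINT z|lborel. norm (f k (x - z) * g z)) \<le> (LINT z|lborel. B X k * C * indicator {0..X} z)"
        using bd integrable_conv[OF f g]
        by (intro integral_mono integrable_norm integrable_cmult_indicator_Icc) auto
      also have "\<dots> = B X k * (C * X)" using X by simp
      finally show "norm (LINT z|lborel. norm (f k (x - z) * g z)) \<le> B X k * (C * X)" by simp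
    qed
  qed
  moreover have "(\<Sum>k. f k (x - z) * g z) = (\<Sum>k. f k (x - z)) * g z" for z
    by (rule suminf_mult2[symmetric]) (rule summable_rabs_cancel[OF s])
  ultimately show ?thesis by (simp add: conv_def)
qed

text \<open>With \<open>a = (q + lam) / c\<close> and \<open>b = lam / c\<close> this is
  \<open>V\<close> of the overview, that is, \<open>c\<close> times the scale function.\<close>

definition potential :: "real \<Rightarrow> real \<Rightarrow> real measure \<Rightarrow> real \<Rightarrow> real" where
  "potential a b \<nu> x = (\<Sum>k. mconv (resolvent_kernel a b k) (convolution_power \<nu> k) x)"

section \<open>Convolution equations for the terms and for their sum\<close>

context
  fixes a b :: real and \<nu> :: "real measure"
  assumes a: "0 \<le> a" and b: "0 \<le> b" and \<nu>: "positive_law \<nu>"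
begin

lemma causal_potential_term: "causal (mconv (resolvent_kernel a b k) (convolution_power \<nu> k))"
  by (intro causal_mconv causal_resolvent_kernel a b positive_law_convolution_power \<nu>)

lemma potential_term_bound:
  assumes "0 \<le> X" "x \<le> X"
  shows "\<bar>mconv (resolvent_kernel a b k) (convolution_power \<nu> k) x\<bar> \<le> exp (a * X) * ((b * X) ^ k / fact k)"
proof (rule mconv_bound[OF positive_law_convolution_power[OF \<nu>] causal_measurable[OF causal_resolvent_kernel[OF a b]]])
  show "\<bar>resolvent_kernel a b k y\<bar> \<le> exp (a * X) * ((b * X) ^ k / fact k)" if "y \<le> x" for y
    using that assms by (intro resolvent_kernel_bound a b) auto
qed

lemma causal_potential: "causal (potential a b \<nu>)"
  and summable_potential: "summable (\<lambda>k. mconv (resolvent_kernel a b k) (convolution_power \<nu> k) x)"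
  using causal_suminf[where f = "\<lambda>k. mconv (resolvent_kernel a b k) (convolution_power \<nu> k)"
      and B = "\<lambda>X k. exp (a * X) * ((b * X) ^ k / fact k)",
      OF causal_potential_term summable_exp_series potential_term_bound]
  by (auto simp: potential_def[abs_def] intro: summable_rabs_cancel)

lemma conv_potential:
  assumes "causal g"
  shows "(\<lambda>k. conv (mconv (resolvent_kernel a b k) (convolution_power \<nu> k)) g x) sums conv (potential a b \<nu>) g x"
  using conv_suminf[where f = "\<lambda>k. mconv (resolvent_kernel a b k) (convolution_power \<nu> k)" and g = g
      and B = "\<lambda>X k. exp (a * X) * ((b * X) ^ k / fact k)",
      OF causal_potential_term assms summable_exp_series potential_term_bound]
  by (auto simp: potential_def[abs_def])

text \<open>Both sides are the triple convolution of \<open>f\<close>, the Heaviside function and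
  \<open>\<nu>\<close>. The factor \<open>mconv heaviside \<nu>\<close> is the distribution function
  of \<open>\<nu>\<close>.\<close>

lemma mconv_heaviside_swap:
  assumes "causal f"
  shows "conv (mconv f \<nu>) heaviside = conv f (mconv heaviside \<nu>)"
  using mconv_conv[OF assms causal_heaviside \<nu>] mconv_conv[OF causal_heaviside assms \<nu>]
  by (metis conv_commute)

text \<open>The recursion of the kernels is convolved with the power \<open>Suc k\<close> of
  \<open>\<nu>\<close>. The kernel of index \<open>k\<close> then meets one factor
  \<open>\<nu>\<close> too many, and the swap moves that factor onto the Heaviside function.\<close>

lemma potential_term_Suc:
  fixes x
  defines "v \<equiv> \<lambda>k. mconv (resolvent_kernel a b k) (convolution_power \<nu> k)"
  shows "v (Suc k) x = a * conv (v (Suc k)) heaviside x - b * conv (v k) (mconv heaviside \<nu>) x"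
proof -
  let ?P = "convolution_power \<nu>"
  have P: "positive_law (?P j)" for j by (rule positive_law_convolution_power[OF \<nu>])
  have w: "causal (resolvent_kernel a b j)" for j by (rule causal_resolvent_kernel[OF a b])
  have v: "causal (v j)" for j unfolding v_def by (rule causal_potential_term)
  have 1: "mconv (resolvent_kernel a b k) (?P (Suc k)) = mconv (v k) \<nu>"
    unfolding v_def convolution_power.simps by (rule mconv_mconv[symmetric, OF w P \<nu>])
  have "v (Suc k) = mconv (conv (\<lambda>y. a * resolvent_kernel a b (Suc k) y + (- b) * resolvent_kernel a b k y) heaviside) (?P (Suc k))"
    unfolding v_def by (subst resolvent_kernel_Suc[OF a b]) (rule refl)
  also have "\<dots> = conv (mconv (\<lambda>y. a * resolvent_kernel a b (Suc k) y + (- b) * resolvent_kernel a b k y) (?P (Suc k))) heaviside"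
    by (intro mconv_conv causal_heaviside P causal_add causal_cmult w)
  also have "mconv (\<lambda>y. a * resolvent_kernel a b (Suc k) y + (- b) * resolvent_kernel a b k y) (?P (Suc k))
      = (\<lambda>y. a * v (Suc k) y + (- b) * mconv (v k) \<nu> y)"
    by (rule ext, subst mconv_add[OF causal_cmult[OF w] causal_cmult[OF w] P])
      (simp only: mconv_cmult 1, simp add: v_def)
  finally have "v (Suc k) x = conv (\<lambda>y. a * v (Suc k) y + (- b) * mconv (v k) \<nu> y) heaviside x"
    by (rule fun_cong)
  also have "\<dots> = a * conv (v (Suc k)) heaviside x + (- b) * conv (mconv (v k) \<nu>) heaviside x"
    by (subst conv_add_left)
      (auto simp only: conv_cmult_left intro!: causal_cmult v causal_mconv \<nu> causal_heaviside)
  finally show ?thesis using mconv_heaviside_swap[OF v, of k] by simp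
qed

text \<open>Summing the recursion of the terms over \<open>k\<close> closes up to an equation for
  the sum; the term of index 0 contributes the inhomogeneity.\<close>

lemma potential_eq:
  "potential a b \<nu> x = heaviside x + a * conv (potential a b \<nu>) heaviside x
      - b * conv (potential a b \<nu>) (mconv heaviside \<nu>) x"
proof -
  define v where "v k = mconv (resolvent_kernel a b k) (convolution_power \<nu> k)" for k
  note [measurable] = causal_measurable[OF causal_resolvent_kernel[OF a b]]
  \<comment> \<open>The zeroth convolution power is the point mass at 0, which leaves the kernel
    unchanged.\<close>
  have "v 0 = resolvent_kernel a b 0"
    unfolding v_def mconv_def convolution_power.simps
    by (rule ext, subst integral_return) auto
  then have v0: "v 0 x = heaviside x + a * conv (v 0) heaviside x"
    using resolvent_kernel_0[OF a b, of x] by simp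
  have F: "causal (mconv heaviside \<nu>)" by (intro causal_mconv causal_heaviside \<nu>)
  have 1: "(\<lambda>k. conv (v k) heaviside x) sums conv (potential a b \<nu>) heaviside x"
    unfolding v_def by (rule conv_potential[OF causal_heaviside])
  have 2: "(\<lambda>k. conv (v k) (mconv heaviside \<nu>) x) sums conv (potential a b \<nu>) (mconv heaviside \<nu>) x"
    unfolding v_def by (rule conv_potential[OF F])
  \<comment> \<open>The first sum starts at index 1, so its zeroth term is subtracted; the second
    starts at 0. Adding \<open>v 0\<close> later cancels the correction.\<close>
  have "(\<lambda>k. a * conv (v (Suc k)) heaviside x - b * conv (v k) (mconv heaviside \<nu>) x) sums
      (a * (conv (potential a b \<nu>) heaviside x - conv (v 0) heaviside x)
       - b * conv (potential a b \<nu>) (mconv heaviside \<nu>) x)"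
    using sums_Suc_iff[of "\<lambda>k. conv (v k) heaviside x"] 1
    by (intro sums_diff sums_mult 2) simp
  then have "(\<lambda>k. v (Suc k) x) sums
      (a * (conv (potential a b \<nu>) heaviside x - conv (v 0) heaviside x)
       - b * conv (potential a b \<nu>) (mconv heaviside \<nu>) x)"
    unfolding v_def by (simp only: potential_term_Suc)
  then have "(\<lambda>k. v k x) sums
      (a * (conv (potential a b \<nu>) heaviside x - conv (v 0) heaviside x)
       - b * conv (potential a b \<nu>) (mconv heaviside \<nu>) x + v 0 x)"
    by (simp only: sums_Suc_iff[of "\<lambda>k. v k x"])
  then show ?thesis
    unfolding v0 by (simp add: potential_def v_def[symmetric] sums_iff algebra_simps)
qed

end

section \<open>The Laplace transform of the potential\<close>

text \<open>An indefinite integral of a locally bounded function is locally Lipschitz.\<close>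

lemma continuous_conv_heaviside:
  assumes f: "causal f" shows "continuous_on S (conv f heaviside)"
proof -
  have int: "integrable lborel (\<lambda>z. f z * indicator {0..x} z)" for x
  proof -
    have "heaviside (x - z) * f z = f z * indicator {0..x} z" for z
      using causal_neg[OF f, of z] by (auto simp: heaviside_def indicator_def)
    then show ?thesis using integrable_conv[OF causal_heaviside f, of x] by (simp only:)
  qed
  have "isCont (conv f heaviside) x" for x
  proof -
    \<comment> \<open>Reaching up to \<open>x + 1\<close> gives a Lipschitz constant valid on a
      neighbourhood of \<open>x\<close>.\<close>
    obtain B where B0: "0 \<le> B" and B[rule_format]: "\<forall>y\<le>x + 1. \<bar>f y\<bar> \<le> B"
      by (rule causal_bound[OF f, where X = "x + 1"])
    have lip: "\<bar>conv f heaviside y - conv f heaviside z\<bar> \<le> B * (y - z)" if "z \<le> y" "y < x + 1" for y z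
    proof -
      have "conv f heaviside y - conv f heaviside z
          = (LINT u|lborel. f u * indicator {0..y} u - f u * indicator {0..z} u)"
        unfolding conv_heaviside[OF f] by (rule Bochner_Integration.integral_diff[symmetric, OF int int])
      also have "\<bar>\<dots>\<bar> \<le> (LINT u|lborel. \<bar>f u * indicator {0..y} u - f u * indicator {0..z} u\<bar>)"
        by (rule integral_abs_bound)
      also have "\<dots> \<le> (LINT u|lborel. B * indicator {z..y} u)"
      proof (intro integral_mono integrable_abs Bochner_Integration.integrable_diff int integrable_cmult_indicator_Icc)
        fix u
        show "\<bar>f u * indicator {0..y} u - f u * indicator {0..z} u\<bar> \<le> B * indicator {z..y} u"
          using B[of u] B0 that by (auto simp: indicator_def)
      qed
      also have "\<dots> = B * (y - z)" using that by simp
      finally show ?thesis .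
    qed
    have "B-lipschitz_on {..<x + 1} (conv f heaviside)"
    proof (rule lipschitz_onI)
      fix y z assume "y \<in> {..<x + 1}" "z \<in> {..<x + 1}"
      then show "dist (conv f heaviside y) (conv f heaviside z) \<le> B * dist y z"
        using lip[of y z] lip[of z y] by (cases "z \<le> y") (auto simp: dist_real_def abs_minus_commute)
    qed (rule B0)
    then have "continuous_on {..<x + 1} (conv f heaviside)" by (rule lipschitz_on_continuous_on)
    then show ?thesis by (simp add: continuous_on_eq_continuous_at)
  qed
  then show ?thesis by (simp add: continuous_at_imp_continuous_on)
qed

text \<open>Extended nonnegative values allow transforms of nonnegative functions to be added and
  multiplied before their finiteness is known.\<close>

definition laplace :: "real \<Rightarrow> (real \<Rightarrow> real) \<Rightarrow> ennreal" where
  "laplace \<beta> f = (\<integral>\<^sup>+x. ennreal (exp (- \<beta> * x) * f x) \<partial>lborel)"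

text \<open>The weight splits as \<open>exp (- \<beta> * (x - z)) * exp (- \<beta> * z)\<close>;
  Tonelli and translation invariance then separate the factors, even when a transform is
  infinite.\<close>

lemma laplace_conv:
  assumes f: "causal f" "\<And>x. 0 \<le> f x" and g: "causal g" "\<And>x. 0 \<le> g x"
  shows "laplace \<beta> (conv f g) = laplace \<beta> f * laplace \<beta> g"
proof -
  note [measurable] = causal_measurable[OF f(1)] causal_measurable[OF g(1)]
  let ?h = "\<lambda>x z. ennreal (exp (- \<beta> * (x - z)) * f (x - z)) * ennreal (exp (- \<beta> * z) * g z)"
  have "ennreal (exp (- \<beta> * x) * conv f g x) = (\<integral>\<^sup>+z. ?h x z \<partial>lborel)" for x
  proof -
    have e: "exp (- \<beta> * x) * (f (x - z) * g z)
        = (exp (- \<beta> * (x - z)) * f (x - z)) * (exp (- \<beta> * z) * g z)" for z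
    proof -
      have "exp (- \<beta> * x) = exp (- \<beta> * (x - z)) * exp (- \<beta> * z)"
        by (simp add: algebra_simps flip: exp_add)
      then show ?thesis by (simp only: mult_ac)
    qed
    have "ennreal (exp (- \<beta> * x) * conv f g x) = ennreal (LINT z|lborel. exp (- \<beta> * x) * (f (x - z) * g z))"
      by (simp add: conv_def)
    also have "\<dots> = (\<integral>\<^sup>+z. ennreal (exp (- \<beta> * x) * (f (x - z) * g z)) \<partial>lborel)"
      by (rule nn_integral_eq_integral[symmetric]) (use f g in \<open>auto intro: integrable_conv\<close>)
    finally show ?thesis by (simp only: e) (simp add: ennreal_mult f(2) g(2))
  qed
  then have "laplace \<beta> (conv f g) = (\<integral>\<^sup>+x. \<integral>\<^sup>+z. ?h x z \<partial>lborel \<partial>lborel)"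
    by (simp add: laplace_def)
  also have "\<dots> = (\<integral>\<^sup>+z. \<integral>\<^sup>+x. ?h x z \<partial>lborel \<partial>lborel)"
    by (rule lborel_pair.Fubini') measurable
  also have "\<dots> = (\<integral>\<^sup>+z. laplace \<beta> f * ennreal (exp (- \<beta> * z) * g z) \<partial>lborel)"
  proof (rule nn_integral_cong)
    fix z
    have "laplace \<beta> f = (\<integral>\<^sup>+x. ennreal (exp (- \<beta> * (x - z)) * f (x - z)) \<partial>lborel)"
      unfolding laplace_def by (subst nn_integral_real_affine[of _ 1 "- z"]) auto
    then show "(\<integral>\<^sup>+x. ?h x z \<partial>lborel) = laplace \<beta> f * ennreal (exp (- \<beta> * z) * g z)"
      by (simp add: nn_integral_multc)
  qed
  also have "\<dots> = laplace \<beta> f * laplace \<beta> g" by (simp add: nn_integral_cmult laplace_def)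
  finally show ?thesis .
qed

text \<open>The same splitting of the weight, with Lebesgue measure in the second variable replaced
  by the law.\<close>

lemma laplace_mconv:
  assumes f: "causal f" "\<And>x. 0 \<le> f x" and P: "positive_law P"
  shows "laplace \<beta> (mconv f P) = laplace \<beta> f * (\<integral>\<^sup>+s. ennreal (exp (- \<beta> * s)) \<partial>P)"
proof -
  interpret P: prob_space P using P by (simp add: positive_law_def)
  interpret PL: pair_sigma_finite lborel P ..
  have [measurable_cong]: "sets P = sets borel" using P by (auto simp: positive_law_def)
  note [measurable] = causal_measurable[OF f(1)]
  let ?h = "\<lambda>x s. ennreal (exp (- \<beta> * (x - s)) * f (x - s)) * ennreal (exp (- \<beta> * s))"
  have "ennreal (exp (- \<beta> * x) * mconv f P x) = (\<integral>\<^sup>+s. ?h x s \<partial>P)" for x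
  proof -
    have e: "exp (- \<beta> * x) * f (x - s) = exp (- \<beta> * (x - s)) * f (x - s) * exp (- \<beta> * s)" for s
    proof -
      have "exp (- \<beta> * x) = exp (- \<beta> * (x - s)) * exp (- \<beta> * s)"
        by (simp add: algebra_simps flip: exp_add)
      then show ?thesis by (simp only: mult_ac)
    qed
    have "ennreal (exp (- \<beta> * x) * mconv f P x) = ennreal (LINT s|P. exp (- \<beta> * x) * f (x - s))"
      by (simp add: mconv_def)
    also have "\<dots> = (\<integral>\<^sup>+s. ennreal (exp (- \<beta> * x) * f (x - s)) \<partial>P)"
      by (rule nn_integral_eq_integral[symmetric]) (use f P in \<open>auto intro: integrable_shift\<close>)
    finally show ?thesis by (simp only: e) (simp add: ennreal_mult f(2))
  qed
  then have "laplace \<beta> (mconv f P) = (\<integral>\<^sup>+x. \<integral>\<^sup>+s. ?h x s \<partial>P \<partial>lborel)"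
    by (simp add: laplace_def)
  also have "\<dots> = (\<integral>\<^sup>+s. \<integral>\<^sup>+x. ?h x s \<partial>lborel \<partial>P)"
    by (rule PL.Fubini'[symmetric]) measurable
  also have "\<dots> = (\<integral>\<^sup>+s. laplace \<beta> f * ennreal (exp (- \<beta> * s)) \<partial>P)"
  proof (rule nn_integral_cong)
    fix s
    have "laplace \<beta> f = (\<integral>\<^sup>+x. ennreal (exp (- \<beta> * (x - s)) * f (x - s)) \<partial>lborel)"
      unfolding laplace_def by (subst nn_integral_real_affine[of _ 1 "- s"]) auto
    then show "(\<integral>\<^sup>+x. ?h x s \<partial>lborel) = laplace \<beta> f * ennreal (exp (- \<beta> * s))"
      by (simp add: nn_integral_multc)
  qed
  also have "\<dots> = laplace \<beta> f * (\<integral>\<^sup>+s. ennreal (exp (- \<beta> * s)) \<partial>P)" by (simp add: nn_integral_cmult)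
  finally show ?thesis .
qed

lemma laplace_heaviside:
  assumes "0 < \<beta>" shows "laplace \<beta> heaviside = ennreal (1 / \<beta>)"
proof -
  have "laplace \<beta> heaviside = (\<integral>\<^sup>+x. ennreal (exp (- \<beta> * x)) * indicator {0..} x \<partial>lborel)"
    unfolding laplace_def by (intro nn_integral_cong) (auto simp: heaviside_def indicator_def)
  also have "\<dots> = ennreal (0 - (- exp (- \<beta> * 0) / \<beta>))"
  proof (rule nn_integral_FTC_atLeast)
    show "((\<lambda>x. - exp (- \<beta> * x) / \<beta>) has_real_derivative exp (- \<beta> * x)) (at x)" for x
      using assms by (auto intro!: derivative_eq_intros)
    have "filterlim (\<lambda>x. \<beta> * x) at_top at_top"
      using assms by (intro filterlim_tendsto_pos_mult_at_top[OF tendsto_const _ filterlim_ident]) auto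
    then have "((\<lambda>x. exp (- (\<beta> * x))) \<longlongrightarrow> 0) at_top"
      by (intro filterlim_compose[OF exp_at_bot]) (simp add: filterlim_uminus_at_bot)
    then show "((\<lambda>x. - exp (- \<beta> * x) / \<beta>) \<longlongrightarrow> 0) at_top"
      using tendsto_divide[OF tendsto_minus tendsto_const[of \<beta>]] assms by fastforce
  qed auto
  finally show ?thesis by simp
qed

section \<open>The renewal kernel, positivity of the potential and its transform\<close>

context
  fixes a b :: real and \<nu> :: "real measure"
  assumes b: "0 \<le> b" and ba: "b \<le> a" and \<nu>: "positive_law \<nu>"
begin

text \<open>In terms of the original parameters, its value at \<open>x \<ge> 0\<close> is
  \<open>q\<close> plus \<open>lam\<close> times the tail of \<open>\<nu>\<close> beyond
  \<open>x\<close>, all divided by \<open>c\<close>.\<close>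

definition renewal_kernel :: "real \<Rightarrow> real" where
  "renewal_kernel x = a * heaviside x + (- b) * mconv heaviside \<nu> x"

lemma drift_nonneg: "0 \<le> a" using b ba by simp

lemma causal_renewal_kernel: "causal renewal_kernel"
  unfolding renewal_kernel_def[abs_def]
  by (intro causal_add causal_cmult causal_mconv causal_heaviside \<nu>)

lemma mconv_heaviside_nonneg: "0 \<le> mconv heaviside \<nu> x"
  unfolding mconv_def by (intro integral_nonneg_AE) (simp add: heaviside_def)

text \<open>A distribution function is at most 1, and \<open>b \<le> a\<close> expresses
  \<open>q \<ge> 0\<close>.\<close>

lemma renewal_kernel_nonneg: "0 \<le> renewal_kernel x"
proof (cases "x < 0")
  case True
  then show ?thesis using causal_neg[OF causal_renewal_kernel] by simp
next
  case False
  have "\<bar>mconv heaviside \<nu> x\<bar> \<le> 1"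
    by (rule mconv_bound[OF \<nu> causal_measurable[OF causal_heaviside]])
      (simp add: heaviside_def indicator_def)
  then have "b * mconv heaviside \<nu> x \<le> a * 1"
    using b ba by (intro mult_mono mconv_heaviside_nonneg) auto
  then show ?thesis using False by (simp add: renewal_kernel_def heaviside_def)
qed

lemma potential_renewal:
  "potential a b \<nu> x = heaviside x + conv (potential a b \<nu>) renewal_kernel x"
proof -
  note V = causal_potential[OF drift_nonneg b \<nu>]
  \<comment> \<open>The factors are exchanged so that linearity in the left factor splits the
    kernel.\<close>
  have "conv (potential a b \<nu>) renewal_kernel x
      = a * conv heaviside (potential a b \<nu>) x + (- b) * conv (mconv heaviside \<nu>) (potential a b \<nu>) x"
    unfolding conv_commute[of "potential a b \<nu>" renewal_kernel] unfolding renewal_kernel_def[abs_def]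
    by (subst conv_add_left)
      (auto simp only: conv_cmult_left intro!: causal_cmult causal_mconv \<nu> causal_heaviside V)
  then show ?thesis
    using potential_eq[OF drift_nonneg b \<nu>, of x] by (simp add: conv_commute[of _ "potential a b \<nu>"])
qed

text \<open>Moving \<open>\<nu>\<close> back onto the potential turns both convolutions of
  \<open>potential_eq\<close> into integrals from 0, and on the half-line the Heaviside term is
  constant.\<close>

lemma continuous_potential: "continuous_on {0..} (potential a b \<nu>)"
proof -
  note V = causal_potential[OF drift_nonneg b \<nu>]
  have U: "causal (\<lambda>y. a * potential a b \<nu> y)" "causal (\<lambda>y. (- b) * mconv (potential a b \<nu>) \<nu> y)"
    by (intro causal_cmult causal_mconv V \<nu>)+
  have "continuous_on {0..} (\<lambda>x. 1 + conv (\<lambda>y. a * potential a b \<nu> y + (- b) * mconv (potential a b \<nu>) \<nu> y) heaviside x)"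
    by (intro continuous_intros continuous_conv_heaviside causal_add U)
  moreover have "1 + conv (\<lambda>y. a * potential a b \<nu> y + (- b) * mconv (potential a b \<nu>) \<nu> y) heaviside x
      = potential a b \<nu> x" if "x \<in> {0..}" for x
    using that potential_eq[OF drift_nonneg b \<nu>, of x]
    unfolding conv_add_left[OF U causal_heaviside] conv_cmult_left mconv_heaviside_swap[OF drift_nonneg b \<nu> V]
    by (simp add: heaviside_def)
  ultimately show ?thesis by (simp cong: continuous_on_cong_simp)
qed

lemma potential_nonneg: "0 \<le> potential a b \<nu> x"
proof (rule ccontr)
  let ?V = "potential a b \<nu>"
  note V = causal_potential[OF drift_nonneg b \<nu>]
  \<comment> \<open>At the first nonpositive value the renewal equation gives a value of at least 1.\<close>
  assume neg: "\<not> 0 \<le> ?V x"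
  then have "0 \<le> x" using causal_neg[OF V, of x] by (cases "x < 0") auto
  have "closed {y \<in> {0..x}. ?V y \<le> 0}"
    by (intro continuous_on_closed_Collect_le continuous_intros continuous_on_subset[OF continuous_potential]) auto
  then have "compact {y \<in> {0..x}. ?V y \<le> 0}"
    by (rule compact_eq_bounded_closed[THEN iffD2, OF conjI, rotated])
      (auto intro: bounded_subset[OF bounded_closed_interval[of 0 x]])
  moreover have "x \<in> {y \<in> {0..x}. ?V y \<le> 0}" using neg \<open>0 \<le> x\<close> by auto
  ultimately obtain x0 where x0: "x0 \<in> {0..x}" "?V x0 \<le> 0" "\<And>y. y \<in> {0..x} \<Longrightarrow> ?V y \<le> 0 \<Longrightarrow> x0 \<le> y"
    using compact_attains_inf[of "{y \<in> {0..x}. ?V y \<le> 0}"] by blast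
  \<comment> \<open>At \<open>z = 0\<close> the integrand contains the value at \<open>x0\<close>
    itself, which may be negative; this single point is a null set.\<close>
  have "AE z in lborel. z \<noteq> (0::real)" by (rule AE_lborel_singleton)
  then have "AE z in lborel. 0 \<le> ?V (x0 - z) * renewal_kernel z"
  proof eventually_elim
    case (elim z)
    show ?case
    proof (cases "0 < z \<and> z \<le> x0")
      case True
      \<comment> \<open>Here \<open>x0 - z\<close> lies in \<open>{0..x}\<close> strictly below
        \<open>x0\<close>, so minimality of \<open>x0\<close> excludes a nonpositive value.\<close>
      then have "0 \<le> ?V (x0 - z)" using x0(1) x0(3)[of "x0 - z"] by fastforce
      then show ?thesis by (intro mult_nonneg_nonneg renewal_kernel_nonneg)
    next
      case False
      then have "z < 0 \<or> x0 - z < 0" using elim by auto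
      then show ?thesis using causal_neg[OF V] causal_neg[OF causal_renewal_kernel] by auto
    qed
  qed
  then have "0 \<le> conv ?V renewal_kernel x0" unfolding conv_def by (rule integral_nonneg_AE)
  then show False using potential_renewal[of x0] x0 by (simp add: heaviside_def)
qed

text \<open>The kernel plus \<open>b\<close> times the distribution function is \<open>a\<close>
  times the Heaviside function, all with nonnegative terms. Their transforms add, and the finite
  second one can be cancelled.\<close>

lemma laplace_renewal_kernel:
  assumes "0 < \<beta>"
  shows "laplace \<beta> renewal_kernel = ennreal ((a - b * (LINT s|\<nu>. exp (- \<beta> * s))) / \<beta>)"
    and "(LINT s|\<nu>. exp (- \<beta> * s)) \<le> 1"
proof -
  interpret N: prob_space \<nu> using \<nu> by (simp add: positive_law_def)
  have [measurable_cong]: "sets \<nu> = sets borel" using \<nu> by (auto simp: positive_law_def)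
  note [measurable] = causal_measurable[OF causal_renewal_kernel] causal_measurable[OF causal_heaviside]
    causal_measurable[OF causal_mconv[OF causal_heaviside \<nu>]]
  let ?m = "LINT s|\<nu>. exp (- \<beta> * s)"
  have ae: "AE s in \<nu>. 0 \<le> s" using \<nu> by (simp add: positive_law_def)
  then have bd: "AE s in \<nu>. exp (- \<beta> * s) \<le> 1" by eventually_elim (use assms in simp)
  have int: "integrable \<nu> (\<lambda>s. exp (- \<beta> * s))"
    by (rule N.integrable_const_bound[of _ 1]) (use bd in auto)
  show m1: "?m \<le> 1"
    using integral_mono_AE[OF int _ bd] by (simp add: N.prob_space)
  have "laplace \<beta> renewal_kernel + ennreal b * laplace \<beta> (mconv heaviside \<nu>)
      = (\<integral>\<^sup>+x. ennreal (exp (- \<beta> * x) * renewal_kernel x) + ennreal b * ennreal (exp (- \<beta> * x) * mconv heaviside \<nu> x) \<partial>lborel)"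
    unfolding laplace_def by (simp add: nn_integral_add nn_integral_cmult)
  also have "\<dots> = (\<integral>\<^sup>+x. ennreal a * ennreal (exp (- \<beta> * x) * heaviside x) \<partial>lborel)"
  proof (rule nn_integral_cong)
    fix x
    show "ennreal (exp (- \<beta> * x) * renewal_kernel x) + ennreal b * ennreal (exp (- \<beta> * x) * mconv heaviside \<nu> x)
      = ennreal a * ennreal (exp (- \<beta> * x) * heaviside x)"
      using renewal_kernel_nonneg[of x] mconv_heaviside_nonneg[of x] b drift_nonneg
      by (simp add: ennreal_mult'[symmetric] ennreal_plus[symmetric] del: ennreal_plus)
        (simp add: renewal_kernel_def algebra_simps)
  qed
  also have "\<dots> = ennreal a * laplace \<beta> heaviside" unfolding laplace_def by (simp add: nn_integral_cmult)
  finally have eq: "laplace \<beta> renewal_kernel + ennreal (b * ?m / \<beta>) = ennreal (a / \<beta>)"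
    using laplace_mconv[OF causal_heaviside _ \<nu>, of \<beta>] laplace_heaviside[OF assms] b drift_nonneg assms
      nn_integral_eq_integral[OF int]
    by (simp add: heaviside_def ennreal_mult'[symmetric] mult_ac)
  have "b * ?m \<le> a" using mult_mono[OF ba m1] b drift_nonneg by simp
  then have "ennreal (a / \<beta>) = ennreal ((a - b * ?m) / \<beta>) + ennreal (b * ?m / \<beta>)"
    using assms b by (subst ennreal_plus[symmetric]) (auto simp: diff_divide_distrib divide_right_mono)
  then show "laplace \<beta> renewal_kernel = ennreal ((a - b * ?m) / \<beta>)"
    using eq ennreal_add_left_cancel by (simp add: add.commute)
qed

text \<open>The transform \<open>j\<close> of the potential satisfies
  \<open>j = 1 / \<beta> + j * \<kappa>\<close>, where \<open>\<kappa>\<close> is the transform of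
  the renewal kernel, and \<open>big\<close> says \<open>\<kappa> < 1\<close>. As an infinite
  \<open>j\<close> would also satisfy this, finiteness is proved first.\<close>

lemma potential_laplace:
  assumes "0 < \<beta>" and big: "a - b * (LINT s|\<nu>. exp (- \<beta> * s)) < \<beta>"
  shows "integrable lborel (\<lambda>x. exp (- \<beta> * x) * potential a b \<nu> x)"
    and "(LINT x|lborel. exp (- \<beta> * x) * potential a b \<nu> x)
      = 1 / (\<beta> - a + b * (LINT s|\<nu>. exp (- \<beta> * s)))"
proof -
  let ?V = "potential a b \<nu>"
  note V = causal_potential[OF drift_nonneg b \<nu>]
  note [measurable] = causal_measurable[OF V]
  define m where "m = (LINT s|\<nu>. exp (- \<beta> * s))"
  define \<kappa> where "\<kappa> = (a - b * m) / \<beta>"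
  have m: "m \<le> 1" unfolding m_def by (rule laplace_renewal_kernel(2)[OF assms(1)])
  have "b * m \<le> a" using mult_left_mono[OF m b] ba by simp
  then have \<kappa>: "0 \<le> \<kappa>" "\<kappa> < 1" using assms by (auto simp: \<kappa>_def m_def)
  have sol: "j = 1 / (\<beta> - a + b * m)" if "j = 1 / \<beta> + j * \<kappa>" for j
    using that assms by (simp add: \<kappa>_def m_def field_simps)
  have laplace_K: "laplace \<beta> renewal_kernel = ennreal \<kappa>"
    unfolding \<kappa>_def m_def by (rule laplace_renewal_kernel(1)[OF assms(1)])
  \<comment> \<open>The truncation makes the transform finite, so that it can be subtracted from both sides.\<close>
  have trunc: "laplace \<beta> (\<lambda>x. ?V x * indicator {..R} x) \<le> ennreal (1 / (\<beta> - a + b * m))" for R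
  proof -
    let ?W = "\<lambda>x. ?V x * indicator {..R} x"
    have W0: "0 \<le> ?W x" for x using potential_nonneg[of x] by simp
    obtain B where B0: "0 \<le> B" and B[rule_format]: "\<forall>y\<le>R. \<bar>?V y\<bar> \<le> B"
      by (rule causal_bound[OF V, where X = R])
    have W: "causal ?W"
      by (rule causalI) (use B B0 causal_neg[OF V] in \<open>auto simp: indicator_def intro!: exI[of _ B]\<close>)
    have cW0: "0 \<le> conv ?W renewal_kernel x" for x
      unfolding conv_def by (intro integral_nonneg_AE AE_I2 mult_nonneg_nonneg W0 renewal_kernel_nonneg)
    \<comment> \<open>Up to \<open>R\<close> the convolution only sees values at arguments at most
      \<open>R\<close>, so the renewal equation persists; beyond \<open>R\<close> the left side is
      0.\<close>
    have le: "?W x \<le> heaviside x + conv ?W renewal_kernel x" for x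
    proof (cases "x \<le> R")
      case True
      have "?W (x - z) * renewal_kernel z = ?V (x - z) * renewal_kernel z" for z
        using True causal_neg[OF causal_renewal_kernel, of z] by (cases "z < 0") (auto simp: indicator_def)
      then have "conv ?W renewal_kernel x = conv ?V renewal_kernel x" by (simp only: conv_def)
      then show ?thesis using potential_renewal[of x] True by simp
    next
      case False
      then show ?thesis using cW0[of x] by (simp add: heaviside_def)
    qed
    \<comment> \<open>A crude bound by \<open>B\<close> on \<open>{0..R}\<close>, used only for
      finiteness.\<close>
    have "laplace \<beta> ?W \<le> (\<integral>\<^sup>+x. ennreal (exp (\<beta> * 0) * B) * indicator {0..R} x \<partial>lborel)"
      unfolding laplace_def
    proof (rule nn_integral_mono)
      fix x
      show "ennreal (exp (- \<beta> * x) * (?V x * indicator {..R} x)) \<le> ennreal (exp (\<beta> * 0) * B) * indicator {0..R} x"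
      proof (cases "0 \<le> x \<and> x \<le> R")
        case True
        then have "exp (- \<beta> * x) * ?V x \<le> 1 * B"
          using B[of x] B0 assms(1) by (intro mult_mono) (auto intro: potential_nonneg)
        then show ?thesis using True by (simp add: ennreal_leI)
      next
        case False
        then show ?thesis using causal_neg[OF V, of x] by (auto simp: indicator_def)
      qed
    qed
    also have "\<dots> < \<infinity>" by (simp add: nn_integral_cmult emeasure_lborel_Icc_eq ennreal_mult_less_top)
    finally have "laplace \<beta> ?W < \<infinity>" .
    then obtain j where j: "0 \<le> j" "laplace \<beta> ?W = ennreal j" by (metis ennreal_cases less_irrefl infinity_ennreal_def)
    have "laplace \<beta> ?W \<le> laplace \<beta> heaviside + laplace \<beta> (conv ?W renewal_kernel)"
      unfolding laplace_def
    proof (subst nn_integral_add[symmetric])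
      show "(\<integral>\<^sup>+x. ennreal (exp (- \<beta> * x) * ?W x) \<partial>lborel) \<le>
        (\<integral>\<^sup>+x. ennreal (exp (- \<beta> * x) * heaviside x) + ennreal (exp (- \<beta> * x) * conv ?W renewal_kernel x) \<partial>lborel)"
      proof (rule nn_integral_mono)
        fix x
        have "ennreal (exp (- \<beta> * x) * ?W x) \<le> ennreal (exp (- \<beta> * x) * heaviside x + exp (- \<beta> * x) * conv ?W renewal_kernel x)"
          using mult_left_mono[OF le[of x], of "exp (- \<beta> * x)"] by (intro ennreal_leI) (simp add: distrib_left)
        also have "\<dots> = ennreal (exp (- \<beta> * x) * heaviside x) + ennreal (exp (- \<beta> * x) * conv ?W renewal_kernel x)"
          by (rule ennreal_plus) (use cW0[of x] in \<open>auto simp: heaviside_def\<close>)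
        finally show "ennreal (exp (- \<beta> * x) * ?W x) \<le> \<dots>" .
      qed
    qed (use causal_measurable[OF causal_conv[OF W causal_renewal_kernel]] causal_measurable[OF causal_heaviside] in measurable)
    also have "\<dots> = ennreal (1 / \<beta> + j * \<kappa>)"
      using j \<kappa> assms(1) unfolding laplace_conv[OF W W0 causal_renewal_kernel renewal_kernel_nonneg] laplace_K laplace_heaviside[OF assms(1)]
      by (simp add: ennreal_mult'[symmetric])
    finally have "ennreal j \<le> ennreal (1 / \<beta> + j * \<kappa>)" using j by simp
    then have "j \<le> 1 / \<beta> + j * \<kappa>"
      by (subst (asm) ennreal_le_iff) (use j \<kappa> assms(1) in \<open>auto intro!: add_nonneg_nonneg\<close>)
    then have "j \<le> 1 / (\<beta> - a + b * m)"
      using assms by (simp add: \<kappa>_def m_def field_simps)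
    then show ?thesis using j by (simp add: ennreal_leI)
  qed
  \<comment> \<open>The bound on the truncated transforms does not depend on \<open>R\<close>, so
    monotone convergence carries it to the whole potential.\<close>
  have fin: "laplace \<beta> ?V \<le> ennreal (1 / (\<beta> - a + b * m))"
  proof -
    let ?f = "\<lambda>n x. ennreal (exp (- \<beta> * x) * (?V x * indicator {..real n} x))"
    have "laplace \<beta> ?V \<le> (\<integral>\<^sup>+x. (SUP n. ?f n x) \<partial>lborel)"
      unfolding laplace_def
    proof (rule nn_integral_mono)
      fix x
      obtain n :: nat where "x \<le> real n" using real_arch_simple by blast
      then have "ennreal (exp (- \<beta> * x) * ?V x) = ?f n x" by simp
      also have "\<dots> \<le> (SUP n. ?f n x)" by (rule SUP_upper) simp
      finally show "ennreal (exp (- \<beta> * x) * ?V x) \<le> (SUP n. ?f n x)" .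
    qed
    also have "\<dots> = (SUP n. \<integral>\<^sup>+x. ?f n x \<partial>lborel)"
    proof (rule nn_integral_monotone_convergence_SUP)
      show "incseq ?f"
        by (intro incseq_SucI le_funI ennreal_leI mult_left_mono)
          (auto intro!: mult_left_mono potential_nonneg simp: indicator_def)
    qed measurable
    also have "\<dots> \<le> ennreal (1 / (\<beta> - a + b * m))"
      using trunc by (intro SUP_least) (simp add: laplace_def)
    finally show ?thesis .
  qed
  then obtain j where j: "0 \<le> j" "laplace \<beta> ?V = ennreal j"
    by (metis ennreal_cases ennreal_less_top leD top.not_eq_extremum)
  have conv0: "0 \<le> conv ?V renewal_kernel x" for x
    unfolding conv_def by (intro integral_nonneg_AE AE_I2 mult_nonneg_nonneg potential_nonneg renewal_kernel_nonneg)
  note [measurable] = causal_measurable[OF causal_conv[OF V causal_renewal_kernel]] causal_measurable[OF causal_heaviside]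
  have "laplace \<beta> ?V = laplace \<beta> heaviside + laplace \<beta> (conv ?V renewal_kernel)"
    unfolding laplace_def
    by (subst nn_integral_add[symmetric], measurable, intro nn_integral_cong, subst potential_renewal)
      (simp add: distrib_left ennreal_plus conv0 heaviside_def)
  also have "\<dots> = ennreal (1 / \<beta> + j * \<kappa>)"
    using j \<kappa> assms(1) unfolding laplace_conv[OF V potential_nonneg causal_renewal_kernel renewal_kernel_nonneg] laplace_K laplace_heaviside[OF assms(1)]
    by (simp add: ennreal_mult'[symmetric])
  finally have "ennreal j = ennreal (1 / \<beta> + j * \<kappa>)" using j by simp
  then have "j = 1 / \<beta> + j * \<kappa>"
    by (subst (asm) ennreal_inj) (use j \<kappa> assms(1) in \<open>auto intro!: add_nonneg_nonneg\<close>)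
  then have "j = 1 / (\<beta> - a + b * m)" by (rule sol)
  then have "(\<integral>\<^sup>+x. ennreal (exp (- \<beta> * x) * ?V x) \<partial>lborel) = ennreal (1 / (\<beta> - a + b * m))"
    using j by (simp add: laplace_def)
  then have "integrable lborel (\<lambda>x. exp (- \<beta> * x) * ?V x) \<and> (LINT x|lborel. exp (- \<beta> * x) * ?V x) = 1 / (\<beta> - a + b * m)"
    by (subst (asm) nn_integral_eq_integrable) (use potential_nonneg assms in \<open>auto simp: m_def\<close>)
  then show "integrable lborel (\<lambda>x. exp (- \<beta> * x) * ?V x)"
    "(LINT x|lborel. exp (- \<beta> * x) * ?V x) = 1 / (\<beta> - a + b * (LINT s|\<nu>. exp (- \<beta> * s)))"
    by (auto simp: m_def)
qed

end

section \<open>Uniqueness for Laplace transforms\<close>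

text \<open>In the variable \<open>u = exp (- x)\<close>, raising \<open>\<beta>\<close> by integers
  multiplies the weight by powers of \<open>u\<close>. So all polynomials in \<open>u\<close>, then
  all continuous functions of \<open>u\<close>, integrate to 0 against a weighted \<open>f\<close>,
  and a bump function rules out a nonzero value.\<close>

lemma laplace_eq_zero_imp_eq_zero:
  fixes f :: "real \<Rightarrow> real"
  assumes cont: "continuous_on {0..} f"
    and int: "\<And>\<beta>. \<beta> > B \<Longrightarrow> set_integrable lborel {0..} (\<lambda>x. exp (- \<beta> * x) * f x)"
    and zero: "\<And>\<beta>. \<beta> > B \<Longrightarrow> (LINT x:{0..}|lborel. exp (- \<beta> * x) * f x) = 0"
    and "0 \<le> x"
  shows "f x = 0"
proof -
  \<comment> \<open>The weight with exponent \<open>B + 1\<close> makes \<open>g\<close> integrable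
    and leaves exactly the powers of \<open>exp (- x)\<close> to be tested.\<close>
  define g where "g x = indicator {0..} x * (exp (- (B + 1) * x) * f x)" for x
  have int_g: "integrable lborel g"
    using int[of "B + 1"] by (simp add: set_integrable_def g_def[abs_def])
  then have [measurable]: "g \<in> borel_measurable borel" by (simp add: borel_measurable_integrable)
  have pw: "integrable lborel (\<lambda>x. exp (- x) ^ n * g x)" "(LINT x|lborel. exp (- x) ^ n * g x) = 0" for n
  proof -
    have eq: "exp (- x) ^ n * g x = indicator {0..} x *\<^sub>R (exp (- (B + 1 + n) * x) * f x)" for x
      by (simp add: g_def exp_of_nat_mult[symmetric] exp_add[symmetric] algebra_simps indicator_def)
    show "integrable lborel (\<lambda>x. exp (- x) ^ n * g x)"
      unfolding eq using int[of "B + 1 + n"] by (simp add: set_integrable_def)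
    show "(LINT x|lborel. exp (- x) ^ n * g x) = 0"
      unfolding eq using zero[of "B + 1 + n"] by (simp add: set_lebesgue_integral_def)
  qed
  have poly: "integrable lborel (\<lambda>x. p (exp (- x)) * g x) \<and> (LINT x|lborel. p (exp (- x)) * g x) = 0"
    if p: "real_polynomial_function p" for p :: "real \<Rightarrow> real"
  proof -
    obtain a n where p_eq: "p = (\<lambda>x. \<Sum>i\<le>n. a i * x ^ i)"
      using real_polynomial_function_imp_sum[OF p] by auto
    have eq: "p (exp (- x)) * g x = (\<Sum>i\<le>n. a i * (exp (- x) ^ i * g x))" for x
      by (simp add: p_eq sum_distrib_right mult.assoc)
    show ?thesis unfolding eq by (auto intro!: Bochner_Integration.integrable_sum pw simp: pw)
  qed
  have test: "(LINT x|lborel. \<phi> (exp (- x)) * g x) = 0" and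
    int_test: "integrable lborel (\<lambda>x. \<phi> (exp (- x)) * g x)"
    if \<phi>: "continuous_on UNIV \<phi>" for \<phi> :: "real \<Rightarrow> real"
  proof -
    have [measurable]: "\<phi> \<in> borel_measurable borel" using \<phi> by (rule borel_measurable_continuous_onI)
    \<comment> \<open>Approximation on \<open>{0..1}\<close> suffices: \<open>exp (- x)\<close> lies
      there for \<open>x \<ge> 0\<close>, and \<open>g\<close> vanishes for
      \<open>x < 0\<close>.\<close>
    have approx: "\<exists>p. real_polynomial_function p \<and> (\<forall>x. \<bar>(\<phi> (exp (- x)) - p (exp (- x))) * g x\<bar> \<le> e * \<bar>g x\<bar>)"
      if e: "e > 0" for e
    proof -
      obtain p where p: "real_polynomial_function p" "\<And>x. x \<in> {0..1} \<Longrightarrow> \<bar>\<phi> x - p x\<bar> < e"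
        using Stone_Weierstrass_real_polynomial_function[OF compact_Icc
            continuous_on_subset[OF \<phi> subset_UNIV] e] by blast
      have "\<bar>(\<phi> (exp (- x)) - p (exp (- x))) * g x\<bar> \<le> e * \<bar>g x\<bar>" for x
      proof (cases "0 \<le> x")
        case True
        then show ?thesis using p(2)[of "exp (- x)"] by (auto simp: abs_mult intro!: mult_right_mono)
      qed (simp add: g_def)
      then show ?thesis using p by blast
    qed
    show int': "integrable lborel (\<lambda>x. \<phi> (exp (- x)) * g x)"
    proof -
      obtain p where p: "real_polynomial_function p"
        "\<And>x. \<bar>(\<phi> (exp (- x)) - p (exp (- x))) * g x\<bar> \<le> 1 * \<bar>g x\<bar>"
        using approx[of 1] by auto
      have [measurable]: "(\<lambda>x. p (exp (- x)) * g x) \<in> borel_measurable borel"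
        using borel_measurable_integrable[OF conjunct1[OF poly[OF p(1)]]] by simp
      have "integrable lborel (\<lambda>x. \<phi> (exp (- x)) * g x - p (exp (- x)) * g x)"
      proof (rule Bochner_Integration.integrable_bound[OF int_g])
        show "AE x in lborel. norm (\<phi> (exp (- x)) * g x - p (exp (- x)) * g x) \<le> norm (g x)"
          using p(2) by (simp add: left_diff_distrib)
      qed measurable
      from Bochner_Integration.integrable_add[OF this conjunct1[OF poly[OF p(1)]]]
      show ?thesis by simp
    qed
    have "\<bar>LINT x|lborel. \<phi> (exp (- x)) * g x\<bar> \<le> e * (LINT x|lborel. \<bar>g x\<bar>)" if "e > 0" for e
    proof -
      obtain p where p: "real_polynomial_function p"
        "\<And>x. \<bar>(\<phi> (exp (- x)) - p (exp (- x))) * g x\<bar> \<le> e * \<bar>g x\<bar>"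
        using approx[OF \<open>e > 0\<close>] by auto
      note int_p = conjunct1[OF poly[OF p(1)]]
      have "(LINT x|lborel. \<phi> (exp (- x)) * g x) = (LINT x|lborel. (\<phi> (exp (- x)) - p (exp (- x))) * g x)"
        using poly[OF p(1)] int' by (simp add: left_diff_distrib)
      also have "\<bar>\<dots>\<bar> \<le> (LINT x|lborel. \<bar>(\<phi> (exp (- x)) - p (exp (- x))) * g x\<bar>)"
        by (rule integral_abs_bound)
      also have "\<dots> \<le> (LINT x|lborel. e * \<bar>g x\<bar>)"
        using int' int_p int_g p(2)
        by (intro integral_mono) (auto simp: left_diff_distrib)
      finally show ?thesis by simp
    qed
    then have "\<bar>LINT x|lborel. \<phi> (exp (- x)) * g x\<bar> \<le> 0 + e" if "e > 0" for e
    proof -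
      let ?C = "LINT x|lborel. \<bar>g x\<bar>"
      have C: "?C \<ge> 0" by simp
      then have "?C + 1 > 0" by linarith
      \<comment> \<open>The summand 1 keeps the divisor positive even if \<open>?C\<close> is
        0.\<close>
      have "e / (?C + 1) * ?C \<le> e"
        using \<open>?C + 1 > 0\<close> that by (simp add: field_simps)
      moreover have "e / (?C + 1) > 0" using \<open>?C + 1 > 0\<close> that by simp
      ultimately show ?thesis
        using \<open>\<And>e. e > 0 \<Longrightarrow> \<bar>LINT x|lborel. \<phi> (exp (- x)) * g x\<bar> \<le> e * ?C\<close>[of "e / (?C + 1)"]
        by linarith
    qed
    then show "(LINT x|lborel. \<phi> (exp (- x)) * g x) = 0"
      using field_le_epsilon[of "\<bar>LINT x|lborel. \<phi> (exp (- x)) * g x\<bar>" 0] by auto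
  qed
  show "f x = 0"
  proof (rule ccontr)
    assume "f x \<noteq> 0"
    define \<sigma> where "\<sigma> = sgn (f x)"
    have "\<sigma> * f x > 0" using \<open>f x \<noteq> 0\<close> by (simp add: \<sigma>_def sgn_if mult_neg_neg)
    have "continuous_on {0..} (\<lambda>y. \<sigma> * f y)" by (intro continuous_intros cont)
    then obtain d where d: "d > 0" "\<And>y. y \<ge> 0 \<Longrightarrow> dist y x < d \<Longrightarrow> dist (\<sigma> * f y) (\<sigma> * f x) < \<sigma> * f x"
      using \<open>0 \<le> x\<close> \<open>\<sigma> * f x > 0\<close> unfolding continuous_on_iff by (metis atLeast_iff)
    \<comment> \<open>The interval extends to the right of \<open>x\<close> only, so it stays in the
      half-line even for \<open>x = 0\<close>; the factor \<open>\<sigma>\<close> makes the function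
      positive there.\<close>
    define r where "r = x + d / 2"
    have "x < r" using d by (simp add: r_def)
    have pos: "\<sigma> * f y > 0" if "x \<le> y" "y \<le> r" for y
      using d(2)[of y] that d(1) \<open>0 \<le> x\<close> by (auto simp: r_def dist_real_def)
    \<comment> \<open>A continuous bump in \<open>u\<close>, positive exactly between
      \<open>exp (- r)\<close> and \<open>exp (- x)\<close>, which corresponds to arguments in
      \<open>{x<..<r}\<close>.\<close>
    define \<phi> where "\<phi> u = max 0 ((u - exp (- r)) * (exp (- x) - u))" for u :: real
    have \<phi>: "continuous_on UNIV (\<lambda>u. \<sigma> * \<phi> u)" unfolding \<phi>_def by (intro continuous_intros)
    have \<phi>0: "\<phi> (exp (- y)) = 0" if "y \<notin> {x<..<r}" for y
    proof -
      have "exp (- y) \<le> exp (- r) \<or> exp (- x) \<le> exp (- y)" using that by auto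
      then have "(exp (- y) - exp (- r)) * (exp (- x) - exp (- y)) \<le> 0"
      proof
        assume "exp (- y) \<le> exp (- r)"
        moreover then have "exp (- y) \<le> exp (- x)" using \<open>x < r\<close> by auto
        ultimately show ?thesis by (intro mult_nonpos_nonneg) auto
      next
        assume "exp (- x) \<le> exp (- y)"
        moreover then have "exp (- r) \<le> exp (- y)" using \<open>x < r\<close> by auto
        ultimately show ?thesis by (intro mult_nonneg_nonpos) auto
      qed
      then show ?thesis by (simp add: \<phi>_def)
    qed
    have \<phi>1: "\<phi> (exp (- y)) > 0" if "y \<in> {x<..<r}" for y
      using that by (auto simp: \<phi>_def less_max_iff_disj intro!: mult_pos_pos)
    have pos': "\<sigma> * \<phi> (exp (- y)) * g y > 0" if "y \<in> {x<..<r}" for y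
    proof -
      have "0 < \<phi> (exp (- y)) * exp (- (B + 1) * y) * (\<sigma> * f y)"
        using that by (intro mult_pos_pos \<phi>1 pos) auto
      then show ?thesis using that \<open>0 \<le> x\<close> by (simp add: g_def mult_ac)
    qed
    have "0 \<le> \<sigma> * \<phi> (exp (- y)) * g y" for y
      using pos'[of y] \<phi>0[of y] by (cases "y \<in> {x<..<r}") auto
    then have "AE y in lborel. \<sigma> * \<phi> (exp (- y)) * g y = 0"
      using integral_nonneg_eq_0_iff_AE[OF int_test[OF \<phi>]] test[OF \<phi>] by auto
    then have "AE y in lborel. y \<notin> {x<..<r}"
      by eventually_elim (use pos' in force)
    then have "emeasure lborel {x<..<r} = 0"
      using AE_iff_null_sets[of "{x<..<r}" lborel] by (auto simp: null_sets_def)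
    then show False using \<open>x < r\<close> by (simp add: emeasure_lborel_Ioo)
  qed
qed

section \<open>The Laplace exponent\<close>

text \<open>Splitting by the value \<open>n\<close> of \<open>N 1\<close>, independence gives the
  Poisson weight times \<open>m ^ n\<close>, where \<open>m\<close> is the Laplace transform of the
  jump law at \<open>u\<close>. These terms sum to an exponential.\<close>

lemma (in prob_space) compound_poisson_mgf:
  assumes lam: "0 < lam" and N: "poisson_process M lam N" and iid: "iid_seq M \<nu> \<xi>"
    and ind: "indep_of_process M N \<xi>" and pos: "AE s in \<nu>. 0 \<le> s" and u: "0 \<le> u"
    and \<nu>: "sets \<nu> = sets borel"
  shows "expectation (\<lambda>\<omega>. exp (u * compound_poisson c N \<xi> 1 \<omega>))
    = exp (c * u - lam * (1 - (LINT s|\<nu>. exp (- u * s))))"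
proof -
  have N1 [measurable]: "N 1 \<in> measurable M (count_space UNIV)"
    using N by (simp add: poisson_process_def)
  have xi_indep: "indep_vars (\<lambda>_. borel) \<xi> {1..}" and xi_distr: "\<And>i. 1 \<le> i \<Longrightarrow> distr M borel (\<xi> i) = \<nu>"
    using iid by (auto simp: iid_seq_def)
  then have xi [measurable]: "random_variable borel (\<xi> i)" if "1 \<le> i" for i
    using that by (auto simp: indep_vars_def)
  define m where "m = (LINT s|\<nu>. exp (- u * s))"
  define Y where "Y n \<omega> = (\<Prod>i\<in>{1..n}. exp (- u * \<xi> i \<omega>))" for n \<omega>
  have Ym [measurable]: "random_variable borel (Y n)" for n
    unfolding Y_def by (intro borel_measurable_prod) auto
  have xi_pos: "AE \<omega> in M. \<forall>i\<ge>1. 0 \<le> \<xi> i \<omega>"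
  proof -
    have "AE \<omega> in M. 0 \<le> \<xi> i \<omega>" if "1 \<le> i" for i
    proof -
      have "AE s in distr M borel (\<xi> i). 0 \<le> s"
        unfolding xi_distr[OF that] by (rule pos)
      then show ?thesis by (subst (asm) AE_distr_iff) (use xi[OF that] in auto)
    qed
    then show ?thesis by (simp add: AE_all_countable)
  qed
  have Y_bd: "AE \<omega> in M. \<forall>n. norm (Y n \<omega>) \<le> 1"
    using xi_pos
  proof eventually_elim
    case (elim \<omega>)
    have "Y n \<omega> \<le> 1" for n
      unfolding Y_def by (intro prod_le_1) (use elim u in auto)
    moreover have "0 \<le> Y n \<omega>" for n unfolding Y_def by (intro prod_nonneg) auto
    ultimately show ?case by auto
  qed
  have Y_int: "integrable M (Y n)" for n
    by (rule integrable_const_bound[of _ 1]) (use Y_bd in auto)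
  have Y_exp: "expectation (Y n) = m ^ n" for n
  proof -
    have E1: "expectation (\<lambda>\<omega>. exp (- u * \<xi> i \<omega>)) = m" if "1 \<le> i" for i
      unfolding m_def xi_distr[OF that, symmetric] by (rule integral_distr[symmetric]) (use xi[OF that] in auto)
    have "indep_vars (\<lambda>_. borel) (\<lambda>i \<omega>. exp (- u * \<xi> i \<omega>)) {1..n}"
      by (rule indep_vars_compose2[where X = \<xi> and M' = "\<lambda>_. borel"])
        (auto intro: indep_vars_subset[OF xi_indep])
    then have "expectation (Y n) = (\<Prod>i\<in>{1..n}. expectation (\<lambda>\<omega>. exp (- u * \<xi> i \<omega>)))"
      unfolding Y_def
    proof (intro indep_vars_lebesgue_integral)
      fix i assume "i \<in> {1..n}"
      then have "1 \<le> i" by simp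
      have "AE \<omega> in M. norm (exp (- u * \<xi> i \<omega>)) \<le> 1"
        using xi_pos by eventually_elim (use \<open>1 \<le> i\<close> u in auto)
      then show "integrable M (\<lambda>\<omega>. exp (- u * \<xi> i \<omega>))"
        by (rule integrable_const_bound) (use xi[OF \<open>1 \<le> i\<close>] in auto)
    qed auto
    also have "\<dots> = (\<Prod>i\<in>{1..n}. m)" by (intro prod.cong refl E1) simp
    finally show ?thesis by simp
  qed
  \<comment> \<open>The Poisson law is given for increments; since \<open>N 0\<close> vanishes
    almost surely, it applies to \<open>N 1\<close> itself.\<close>
  have pN: "prob {\<omega> \<in> space M. N 1 \<omega> = n} = lam ^ n / fact n * exp (- lam)" for n
  proof -
    have N0: "AE \<omega> in M. N 0 \<omega> = 0" and [measurable]: "N 0 \<in> measurable M (count_space UNIV)"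
      using N by (auto simp: poisson_process_def)
    have "prob {\<omega> \<in> space M. N 1 \<omega> = n} = prob {\<omega> \<in> space M. N 1 \<omega> = N 0 \<omega> + n}"
    proof (rule finite_measure_eq_AE)
      have "{\<omega> \<in> space M. \<exists>j. N 0 \<omega> = j \<and> N 1 \<omega> = j + n} \<in> events" by measurable
      then show "{\<omega> \<in> space M. N 1 \<omega> = N 0 \<omega> + n} \<in> events" by simp
    qed (use N0 in auto)
    also have "\<dots> = pmf (poisson_pmf (lam * (1 - 0))) n"
      using N by (simp add: poisson_process_def)
    also have "\<dots> = lam ^ n / fact n * exp (- lam)" using lam by (subst pmf_poisson) auto
    finally show ?thesis .
  qed
  \<comment> \<open>For each outcome exactly one index \<open>n\<close> can contribute, so the
    series recovers the product with the random number \<open>N 1\<close> of factors.\<close>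
  define A where "A n \<omega> = indicator {\<omega> \<in> space M. N 1 \<omega> = n} \<omega> * Y n \<omega>" for n \<omega>
  have A_exp: "expectation (A n) = lam ^ n / fact n * exp (- lam) * m ^ n" for n
  proof -
    let ?I = "\<lambda>\<omega>. indicator {\<omega> \<in> space M. N 1 \<omega> = n} \<omega> :: real"
    let ?F = "vimage_algebra (space M) (\<lambda>\<omega>. \<lambda>t\<in>{0..}. N t \<omega>) (\<Pi>\<^sub>M t\<in>{0..}. count_space UNIV)"
    let ?G = "vimage_algebra (space M) (\<lambda>\<omega>. \<lambda>i\<in>{1..}. \<xi> i \<omega>) (\<Pi>\<^sub>M i\<in>{1..}. borel)"
    \<comment> \<open>Independence is given for the sigma-algebras of the two families. It passes to
      the indicator and to \<open>Y n\<close> once each is measurable for the algebra of its own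
      family.\<close>
    have sub: "sigma_sets (space M) {Z -` S \<inter> space M |S. S \<in> sets borel} \<subseteq> sets H"
      if "Z \<in> borel_measurable H" "space H = space M" for Z :: "'a \<Rightarrow> real" and H
    proof -
      have "{Z -` S \<inter> space M |S. S \<in> sets borel} \<subseteq> sets H"
        using measurable_sets[OF that(1)] that(2) by auto
      then show ?thesis using sets.sigma_sets_subset[of _ H] that(2) by simp
    qed
    have "N 1 \<in> measurable ?F (count_space UNIV)"
    proof -
      have "(\<lambda>\<omega>. \<lambda>t\<in>{0..}. N t \<omega>) \<in> measurable ?F (\<Pi>\<^sub>M t\<in>{0..}. count_space UNIV)"
        by (rule measurable_vimage_algebra1) (auto simp: space_PiM)
      from measurable_compose[OF this measurable_component_singleton[of "1::real"]]
      show ?thesis by (simp only: restrict_apply atLeast_iff zero_le_one if_True)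
    qed
    note N1F = this
    have mI: "?I \<in> borel_measurable ?F"
    proof -
      have "(\<lambda>\<omega>. indicator {n} (N 1 \<omega>) :: real) \<in> borel_measurable ?F"
        by (rule measurable_compose[OF N1F]) simp
      then show ?thesis by (rule measurable_cong[THEN iffD1, rotated]) (auto simp: indicator_def)
    qed
    have "\<xi> i \<in> borel_measurable ?G" if "1 \<le> i" for i
    proof -
      have "(\<lambda>\<omega>. \<lambda>i\<in>{1..}. \<xi> i \<omega>) \<in> measurable ?G (\<Pi>\<^sub>M i\<in>{1..}. borel)"
        by (rule measurable_vimage_algebra1) (auto simp: space_PiM)
      from measurable_compose[OF this measurable_component_singleton[of i]] that
      show ?thesis by (simp only: restrict_apply atLeast_iff if_True)
    qed
    then have mY: "Y n \<in> borel_measurable ?G"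
      unfolding Y_def by (intro borel_measurable_prod) auto
    have "indep_set (sigma_sets (space M) {?I -` S \<inter> space M |S. S \<in> sets borel})
        (sigma_sets (space M) {Y n -` S \<inter> space M |S. S \<in> sets borel})"
    proof -
      have "indep_set (sets ?F) (sets ?G)" using ind by (simp add: indep_of_process_def)
      then show ?thesis
        unfolding indep_set_def
        by (rule indep_sets_mono_sets) (use sub[OF mI] sub[OF mY] in \<open>auto split: bool.splits\<close>)
    qed
    then have "indep_var borel ?I borel (Y n)"
      unfolding indep_var_eq by (intro conjI) auto
    moreover have "integrable M ?I"
      by (rule integrable_const_bound[of _ 1]) (auto simp: indicator_def)
    ultimately have "expectation (A n) = expectation ?I * expectation (Y n)"
      unfolding A_def by (intro indep_var_lebesgue_integral Y_int)
    also have "expectation ?I = lam ^ n / fact n * exp (- lam)" by (simp add: pN)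
    finally show ?thesis by (simp add: Y_exp)
  qed
  have [measurable]: "A n \<in> borel_measurable M" for n unfolding A_def by measurable
  have A_bd: "\<bar>A n \<omega>\<bar> \<le> \<bar>Y n \<omega>\<bar>" for n \<omega> by (simp add: A_def indicator_def)
  have A_int: "integrable M (A n)" for n
    by (rule Bochner_Integration.integrable_bound[OF Y_int[of n]]) (use A_bd in auto)
  have m0: "0 \<le> m" unfolding m_def by simp
  have A0: "0 \<le> A n \<omega>" for n \<omega>
    unfolding A_def Y_def by (intro mult_nonneg_nonneg prod_nonneg) auto
  have sums: "(\<lambda>n. lam ^ n / fact n * exp (- lam) * m ^ n) sums (exp (- lam) * exp (lam * m))"
  proof -
    have "(\<lambda>n. exp (- lam) * ((lam * m) ^ n /\<^sub>R fact n)) sums (exp (- lam) * exp (lam * m))"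
      by (intro sums_mult exp_converges)
    then show ?thesis by (simp add: field_simps power_mult_distrib)
  qed
  have single: "A n \<omega> = (if n = N 1 \<omega> then Y n \<omega> else 0)" if "\<omega> \<in> space M" for n \<omega>
    using that by (simp add: A_def indicator_def)
  have Asums: "(\<lambda>n. A n \<omega>) sums Y (N 1 \<omega>) \<omega>" if "\<omega> \<in> space M" for \<omega>
    using sums_single[of "N 1 \<omega>" "\<lambda>n. Y n \<omega>"] by (simp only: single[OF that])
  have "(\<lambda>n. expectation (A n)) sums expectation (\<lambda>\<omega>. \<Sum>n. A n \<omega>)"
  proof (rule sums_integral[OF A_int])
    show "AE \<omega> in M. summable (\<lambda>n. norm (A n \<omega>))"
      using Asums A0 by (intro AE_I2) (auto simp: sums_iff)
    show "summable (\<lambda>n. expectation (\<lambda>\<omega>. norm (A n \<omega>)))"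
      using sums A0 A_exp by (simp add: sums_iff)
  qed
  then have "expectation (\<lambda>\<omega>. \<Sum>n. A n \<omega>) = exp (- lam) * exp (lam * m)"
    using sums_unique2[OF _ sums] by (simp only: A_exp)
  moreover have "expectation (\<lambda>\<omega>. exp (u * compound_poisson c N \<xi> 1 \<omega>)) = expectation (\<lambda>\<omega>. exp (c * u) * (\<Sum>n. A n \<omega>))"
  proof (rule Bochner_Integration.integral_cong[OF refl])
    fix \<omega> assume w: "\<omega> \<in> space M"
    have "(\<Sum>n. A n \<omega>) = (\<Prod>i\<in>{1..N 1 \<omega>}. exp (- u * \<xi> i \<omega>))"
      using sums_unique[OF Asums[OF w]] by (simp add: Y_def)
    also have "\<dots> = exp (- u * (\<Sum>i\<in>{1..N 1 \<omega>}. \<xi> i \<omega>))"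
      by (simp add: exp_sum sum_distrib_left)
    finally show "exp (u * compound_poisson c N \<xi> 1 \<omega>) = exp (c * u) * (\<Sum>n. A n \<omega>)"
      by (simp add: compound_poisson_def algebra_simps flip: exp_add)
  qed
  ultimately have "expectation (\<lambda>\<omega>. exp (u * compound_poisson c N \<xi> 1 \<omega>)) = exp (c * u) * (exp (- lam) * exp (lam * m))"
    by simp
  also have "\<dots> = exp (c * u - lam * (1 - m))" by (simp add: algebra_simps flip: exp_add)
  finally show ?thesis by (simp add: m_def)
qed

section \<open>The scale function\<close>

text \<open>The linear lower bound drives \<open>\<psi>\<close> above every level. By the
  intermediate value theorem, each \<open>y\<close> with \<open>\<psi> y \<le> q\<close> has a root
  of \<open>\<psi> = q\<close> at or to the right of it, hence \<open>y < \<beta>\<close>. Both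
  claims follow by taking \<open>y = 0\<close> and \<open>y = \<beta>\<close>.\<close>

lemma right_inverse_less:
  assumes cont: "continuous_on {0..} \<psi>" and "\<psi> 0 \<le> q" and "0 < c"
    and lower: "\<And>u. 0 \<le> u \<Longrightarrow> c * u - d \<le> \<psi> u"
    and \<beta>: "right_inverse \<psi> q < \<beta>"
  shows "0 < \<beta>" and "q < \<psi> \<beta>"
proof -
  define S where "S = {y. 0 \<le> y \<and> \<psi> y = q}"
  \<comment> \<open>Without an upper bound, \<open>Sup\<close> on the reals would carry no
    information about the members of \<open>S\<close>.\<close>
  have "bdd_above S"
  proof (rule bdd_aboveI)
    fix y assume "y \<in> S"
    then have "c * y - d \<le> q" using lower[of y] by (auto simp: S_def)
    then show "y \<le> (q + d) / c" using \<open>0 < c\<close> by (simp add: field_simps)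
  qed
  have less: "y < \<beta>" if y: "0 \<le> y" "\<psi> y \<le> q" for y
  proof -
    \<comment> \<open>From \<open>(q + d) / c\<close> on, the linear lower bound is at least
      \<open>q\<close>.\<close>
    define T where "T = max y ((q + d) / c)"
    have "q \<le> c * T - d" using \<open>0 < c\<close> by (simp add: T_def max_def field_simps)
    also have "\<dots> \<le> \<psi> T" using y by (intro lower) (simp add: T_def)
    finally obtain z where z: "y \<le> z" "\<psi> z = q"
      using IVT'[of \<psi> y q T] y continuous_on_subset[OF cont, of "{y..T}"] by (auto simp: T_def)
    then have "z \<in> S" using y by (simp add: S_def)
    then have "z \<le> right_inverse \<psi> q"
      unfolding right_inverse_def S_def[symmetric] by (rule cSup_upper) fact
    then show ?thesis using z \<beta> by simp
  qed
  show "0 < \<beta>" by (rule less) (use assms in auto)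
  then show "q < \<psi> \<beta>" using less[of \<beta>] by force
qed

lemma continuous_on_LINT_exp:
  assumes "positive_law \<nu>"
  shows "continuous_on {0..} (\<lambda>u. LINT s|\<nu>. exp (- u * s))"
proof (rule continuous_on_sequentiallyI)
  interpret prob_space \<nu> using assms by (simp add: positive_law_def)
  have [measurable_cong]: "sets \<nu> = sets borel" using assms by (auto simp: positive_law_def)
  fix v :: "nat \<Rightarrow> real" and u assume v: "\<forall>n. v n \<in> {0..}" "v \<longlonglongrightarrow> u"
  show "(\<lambda>n. LINT s|\<nu>. exp (- v n * s)) \<longlonglongrightarrow> (LINT s|\<nu>. exp (- u * s))"
  proof (rule integral_dominated_convergence[where w = "\<lambda>_. 1"])
    show "AE s in \<nu>. (\<lambda>n. exp (- v n * s)) \<longlonglongrightarrow> exp (- u * s)"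
      by (intro AE_I2 tendsto_intros v)
    have "AE s in \<nu>. 0 \<le> s" using assms by (simp add: positive_law_def)
    then show "AE s in \<nu>. norm (exp (- v n * s)) \<le> 1" for n
      by eventually_elim (use v in \<open>auto intro: mult_nonneg_nonneg\<close>)
  qed auto
qed

text \<open>On the half-line the difference is continuous with vanishing transform; on the negative
  axis both functions are 0 by the encoding.\<close>

lemma is_scale_function_unique:
  assumes W: "is_scale_function \<psi> q W" and W': "is_scale_function \<psi> q W'"
  shows "W = W'"
proof
  fix x
  show "W x = W' x"
  proof (cases "0 \<le> x")
    case True
    have "W x - W' x = 0"
    proof (rule laplace_eq_zero_imp_eq_zero[where B = "right_inverse \<psi> q", OF _ _ _ True])
      show "continuous_on {0..} (\<lambda>x. W x - W' x)"
        using W W' by (intro continuous_intros) (auto simp: is_scale_function_def)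
      fix \<beta> assume "right_inverse \<psi> q < \<beta>"
      then have s: "set_integrable lborel {0..} (\<lambda>x. exp (- \<beta> * x) * W x)"
        "set_integrable lborel {0..} (\<lambda>x. exp (- \<beta> * x) * W' x)"
        "(LINT x:{0..}|lborel. exp (- \<beta> * x) * W x) = (LINT x:{0..}|lborel. exp (- \<beta> * x) * W' x)"
        using W W' by (auto simp: is_scale_function_def)
      show "set_integrable lborel {0..} (\<lambda>x. exp (- \<beta> * x) * (W x - W' x))"
        unfolding right_diff_distrib by (rule set_integral_diff(1)[OF s(1,2)])
      show "(LINT x:{0..}|lborel. exp (- \<beta> * x) * (W x - W' x)) = 0"
        unfolding right_diff_distrib using set_integral_diff(2)[OF s(1,2)] s(3) by simp
    qed
    then show ?thesis by simp
  qed (use W W' in \<open>auto simp: is_scale_function_def\<close>)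
qed

text \<open>For \<open>s \<ge> 0\<close>, the cut of the kernel at \<open>x - s < 0\<close> is the
  restriction of the integral to \<open>{0..x}\<close>.\<close>

lemma mconv_resolvent_kernel:
  assumes P: "positive_law P"
  shows "mconv (resolvent_kernel ((q + lam) / c) (lam / c) k) P x
    = (LINT s:{0..x}|P. scale_kernel c lam q k s x)"
proof -
  have [measurable_cong]: "sets P = sets borel" using P by (auto simp: positive_law_def)
  have ae: "AE s in P. 0 \<le> s" using P by (simp add: positive_law_def)
  show ?thesis
    unfolding mconv_def set_lebesgue_integral_def
  proof (rule integral_cong_AE)
    show "(\<lambda>s. resolvent_kernel ((q + lam) / c) (lam / c) k (x - s)) \<in> borel_measurable P"
      unfolding resolvent_kernel_def by measurable
    show "(\<lambda>s. indicator {0..x} s *\<^sub>R scale_kernel c lam q k s x) \<in> borel_measurable P"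
      unfolding scale_kernel_def by measurable
    show "AE s in P. resolvent_kernel ((q + lam) / c) (lam / c) k (x - s)
        = indicator {0..x} s *\<^sub>R scale_kernel c lam q k s x"
      using ae
    proof eventually_elim
      case (elim s)
      have "r * (x - s) = - r * (s - x)" for r :: real by (simp add: algebra_simps)
      then have "(q + lam) / c * (x - s) = - ((q + lam) / c) * (s - x)" .
      then show ?case using elim by (simp add: resolvent_kernel_def scale_kernel_def indicator_def)
    qed
  qed
qed

text \<open>With \<open>m\<close> the transform of \<open>\<nu>\<close> at \<open>\<beta>\<close>,
  \<open>c * (\<beta> - a + b * m)\<close> equals \<open>\<psi> \<beta> - q\<close>, so dividing the
  potential by \<open>c\<close> gives the required transform.\<close>

lemma is_scale_function_potential:
  assumes c: "0 < c" and lam: "0 < lam" and q: "0 \<le> q" and \<nu>: "positive_law \<nu>"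
    and \<psi>: "\<And>u. 0 \<le> u \<Longrightarrow> \<psi> u = c * u - lam * (1 - (LINT s|\<nu>. exp (- u * s)))"
  shows "is_scale_function \<psi> q (\<lambda>x. 1 / c * potential ((q + lam) / c) (lam / c) \<nu> x)"
proof -
  define a where "a = (q + lam) / c"
  define b where "b = lam / c"
  let ?V = "potential a b \<nu>" and ?m = "\<lambda>u. LINT s|\<nu>. exp (- u * s)"
  have ab: "0 \<le> b" "b \<le> a" "0 \<le> a" using c lam q by (auto simp: a_def b_def divide_right_mono)
  interpret N: prob_space \<nu> using \<nu> by (simp add: positive_law_def)
  have neg: "?V x = 0" if "x < 0" for x by (rule causal_neg[OF causal_potential[OF ab(3,1) \<nu>] that])
  have "continuous_on {0..} \<psi>"
    by (subst continuous_on_cong[OF refl \<psi>])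
      (auto intro!: continuous_intros continuous_on_LINT_exp[OF \<nu>, simplified])
  moreover have "\<psi> 0 \<le> q" using q by (simp add: \<psi> N.prob_space)
  moreover have "c * u - lam \<le> \<psi> u" if "0 \<le> u" for u
    using that lam by (simp add: \<psi> algebra_simps)
  ultimately have \<beta>: "0 < \<beta>" "q < \<psi> \<beta>" if "right_inverse \<psi> q < \<beta>" for \<beta>
    using right_inverse_less[of \<psi> q c lam \<beta>] c that by auto
  have lap: "set_integrable lborel {0..} (\<lambda>x. exp (- \<beta> * x) * (1 / c * ?V x))"
    "(LINT x:{0..}|lborel. exp (- \<beta> * x) * (1 / c * ?V x)) = 1 / (\<psi> \<beta> - q)"
    if "right_inverse \<psi> q < \<beta>" for \<beta>
  proof -
    note \<beta> = \<beta>[OF that]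
    have psi: "c * (\<beta> - a + b * ?m \<beta>) = \<psi> \<beta> - q"
    proof -
      have "c * (\<beta> - a + b * ?m \<beta>) = c * \<beta> - c * a + c * b * ?m \<beta>" by (simp add: algebra_simps)
      also have "c * a = q + lam" using c by (simp add: a_def)
      also have "c * b = lam" using c by (simp add: b_def)
      finally have "c * (\<beta> - a + b * ?m \<beta>) = c * \<beta> - (q + lam) + lam * ?m \<beta>" .
      also have "\<dots> = \<psi> \<beta> - q" using \<beta>(1) by (simp add: \<psi> algebra_simps)
      finally show ?thesis .
    qed
    \<comment> \<open>Division by \<open>c\<close> turns \<open>q < \<psi> \<beta>\<close> into the
      condition that the renewal kernel has transform below 1.\<close>
    then have "a - b * ?m \<beta> < \<beta>" using \<beta>(2) c by (smt (verit) zero_less_mult_pos)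
    note laplace = potential_laplace[OF ab(1,2) \<nu> \<beta>(1) this]
    have eq: "indicator {0..} x *\<^sub>R (exp (- \<beta> * x) * (1 / c * ?V x)) = 1 / c * (exp (- \<beta> * x) * ?V x)" for x
      using neg[of x] by (cases "x < 0") (simp_all add: indicator_def)
    show "set_integrable lborel {0..} (\<lambda>x. exp (- \<beta> * x) * (1 / c * ?V x))"
      unfolding set_integrable_def eq by (intro integrable_mult_right laplace(1))
    have "(LINT x:{0..}|lborel. exp (- \<beta> * x) * (1 / c * ?V x)) = 1 / c * (1 / (\<beta> - a + b * ?m \<beta>))"
      unfolding set_lebesgue_integral_def eq by (subst integral_mult_right_zero) (simp only: laplace(2))
    also have "\<dots> = 1 / (\<psi> \<beta> - q)" unfolding psi[symmetric] by simp
    finally show "(LINT x:{0..}|lborel. exp (- \<beta> * x) * (1 / c * ?V x)) = 1 / (\<psi> \<beta> - q)" .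
  qed
  show ?thesis
    unfolding is_scale_function_def a_def[symmetric] b_def[symmetric]
    by (intro conjI allI impI continuous_intros continuous_potential[OF ab(1,2) \<nu>] lap)
      (simp_all add: neg)
qed

theorem theorem3p1:
  fixes M :: "'a measure" and \<nu> :: "real measure"
    and N :: "real \<Rightarrow> 'a \<Rightarrow> nat" and \<xi> :: "nat \<Rightarrow> 'a \<Rightarrow> real"
    and c lam :: real and L :: "real \<Rightarrow> 'a \<Rightarrow> real"
  assumes "prob_space M"
    and "c > 0" and "lam > 0"
    and "prob_space \<nu>" and "sets \<nu> = sets borel" and "measure \<nu> {0<..} = 1"
    and "poisson_process M lam N"
    and "iid_seq M \<nu> \<xi>"
    and "indep_of_process M N \<xi>"
    and L: "\<And>t \<omega>. t \<ge> 0 \<Longrightarrow> \<omega> \<in> space M \<Longrightarrow> L t \<omega> = compound_poisson c N \<xi> t \<omega>"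
  shows "\<forall>q\<ge>0. \<forall>x\<ge>0.
    summable (\<lambda>k. LINT s:{0..x}|convolution_power \<nu> k. scale_kernel c lam q k s x) \<and>
    scale_function (laplace_exponent M L) q x =
      1 / c * (\<Sum>k. LINT s:{0..x}|convolution_power \<nu> k. scale_kernel c lam q k s x)"
proof (intro allI impI)
  fix q x :: real assume q: "0 \<le> q" and "0 \<le> x"
  interpret prob_space M by fact
  have "AE s in \<nu>. s \<in> {0<..}" by (rule prob_space.AE_prob_1) fact+
  then have "AE s in \<nu>. 0 \<le> s" by eventually_elim simp
  then have \<nu>: "positive_law \<nu>" using assms by (simp add: positive_law_def)
  let ?\<psi> = "laplace_exponent M L" and ?V = "potential ((q + lam) / c) (lam / c) \<nu>"
  have "?\<psi> u = c * u - lam * (1 - (LINT s|\<nu>. exp (- u * s)))" if "0 \<le> u" for u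
  proof -
    have "expectation (\<lambda>\<omega>. exp (u * L 1 \<omega>)) = expectation (\<lambda>\<omega>. exp (u * compound_poisson c N \<xi> 1 \<omega>))"
      by (intro Bochner_Integration.integral_cong) (simp_all add: L)
    also have "\<dots> = exp (c * u - lam * (1 - (LINT s|\<nu>. exp (- u * s))))"
      by (rule compound_poisson_mgf) (use assms that \<open>AE s in \<nu>. 0 \<le> s\<close> in auto)
    finally show ?thesis by (simp add: laplace_exponent_def)
  qed
  then have "is_scale_function ?\<psi> q (\<lambda>x. 1 / c * ?V x)"
    using assms q \<nu> by (intro is_scale_function_potential) auto
  \<comment> \<open>Existence together with uniqueness resolves the definite description.\<close>
  then have "scale_function ?\<psi> q = (\<lambda>x. 1 / c * ?V x)"
    unfolding scale_function_def by (intro the_equality is_scale_function_unique)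
  moreover have "mconv (resolvent_kernel ((q + lam) / c) (lam / c) k) (convolution_power \<nu> k) x
      = (LINT s:{0..x}|convolution_power \<nu> k. scale_kernel c lam q k s x)" for k
    by (rule mconv_resolvent_kernel[OF positive_law_convolution_power[OF \<nu>]])
  moreover have "summable (\<lambda>k. mconv (resolvent_kernel ((q + lam) / c) (lam / c) k) (convolution_power \<nu> k) x)"
    using assms(2,3) q by (intro summable_potential \<nu>) auto
  ultimately show "summable (\<lambda>k. LINT s:{0..x}|convolution_power \<nu> k. scale_kernel c lam q k s x) \<and>
    scale_function ?\<psi> q x = 1 / c * (\<Sum>k. LINT s:{0..x}|convolution_power \<nu> k. scale_kernel c lam q k s x)"
    by (simp add: potential_def)
qed

end
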